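(* For every positive integer $\alpha$, the competitive ratio of the $\alpha$-lazy on-line bipartite matching problem, $\liminf_{n\to\infty}\mathrm{Val}_\alpha(n)/n$, which also equals the competitive ratio of the algorithm $\alpha$-Balanced, is $$1-\frac{\alpha}{1+\alpha}\prod_{i=1}^{\alpha-1}\frac{i+i^2}{1+i+i^2}.$$ As $\alpha\to\infty$ this value converges to $1-\pi/\cosh\!\left(\frac{\sqrt3}{2}\pi\right)\approx 0.588$.
   Context: The $\alpha$-lazy matching game ($\alpha$ a positive integer) is played by Scheduler and Builder on a finite set $D$ known in advance, for finitely many rounds. In each round: (1) Builder presents a new vertex $u$ together with its neighbourhood $N(u)\subseteq D$; (2) Scheduler chooses a set $m(u)\subseteq N(u)$ with $|m(u)|\le\alpha$, and then replaces $m(x)$ by $m(x)\setminus m(u)$ for every vertex $x$ presented earlier. Let $U$ be the set of all presented vertices and $G=(U,D,E)$ the bipartite graph with $(u,d)\in E$ iff $d\in N(u)$. The size $n$ of the game is the maximum size of a matching in $G$. The size of the matching constructed by Scheduler is the number of $u\in U$ with $m(u)\neq\emptyset$ at the end. For a Scheduler algorithm $\mathcal A$, $\mathrm{Val}_{\mathcal A}(n)$ is the minimum, over all games of size $n$, of the size of the matching constructed by $\mathcal A$; $\mathrm{Val}_\alpha(n)=\max_{\mathcal A}\mathrm{Val}_{\mathcal A}(n)$. The competitive ratio of $\mathcal A$ is $\liminf_{n\to\infty}\mathrm{Val}_{\mathcal A}(n)/n$ and that of the problem is $\liminf_{n\to\infty}\mathrm{Val}_\alpha(n)/n$. At any moment,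 $d\in D$ is available for $u$ if $d\in N(u)$ and $m(x)\neq\{d\}$ for every $x$ presented earlier; $d$ is strongly available for $u$ if it is available for $u$ and belongs to no set $m(x)$; a presented vertex $e$ is ready for $u$ if $m(e)$ contains an element available for $u$. Algorithm $\alpha$-Balanced: when $u$ is presented (with $U$ the set of vertices presented so far, including $u$), set $m(u):=\emptyset$; put into $m(u)$ as many strongly available elements for $u$ as possible, but at most $\alpha$; then, while there exists $e\in U$ ready for $u$ with $|m(u)|+2\le|m(e)|$, choose among all such $e$ one with $|m(e)|$ maximal and move one element available for $u$ from $m(e)$ to $m(u)$. *)

theory Defs
  imports "HOL-Analysis.Analysis"
begin

section \<open>The game\<close>

text \<open>
  The set \<open>D\<close> consists of natural numbers, and the vertex presented in round \<open>k = 0, 1, \<dots>\<close>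
  is named \<open>k\<close>, so the moves of Builder form the list of presented neighbourhoods.
  A list suffices although Builder may adapt to Scheduler, because Scheduler is deterministic.
\<close>

definition is_game :: "nat set \<Rightarrow> nat set list \<Rightarrow> bool" where
  "is_game D Ns \<longleftrightarrow> finite D \<and> (\<forall>N\<in>set Ns. N \<subseteq> D)"

definition game_edges :: "nat set list \<Rightarrow> (nat \<times> nat) set" where
  "game_edges Ns = {(u, d). u < length Ns \<and> d \<in> Ns ! u}"

definition is_matching :: "('u \<times> 'd) set \<Rightarrow> ('u \<times> 'd) set \<Rightarrow> bool" where
  "is_matching E M \<longleftrightarrow>
     M \<subseteq> E \<and> (\<forall>e\<in>M. \<forall>f\<in>M. e \<noteq> f \<longrightarrow> fst e \<noteq> fst f \<and> snd e \<noteq> snd f)"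

definition game_size :: "nat set list \<Rightarrow> nat" where
  "game_size Ns = Max {card M | M. is_matching (game_edges Ns) M}"

text \<open>
  A Scheduler algorithm maps \<open>D\<close>, the list of earlier neighbourhoods and the neighbourhood
  of the new vertex \<open>u\<close> to the chosen set \<open>m u\<close>; its own earlier choices are determined by
  the earlier neighbourhoods.
\<close>

type_synonym scheduler = "nat set \<Rightarrow> nat set list \<Rightarrow> nat set \<Rightarrow> nat set"

definition lazy_scheduler :: "nat \<Rightarrow> scheduler \<Rightarrow> bool" where
  "lazy_scheduler \<alpha> A \<longleftrightarrow>
     (\<forall>D Ns N. is_game D (Ns @ [N]) \<longrightarrow> A D Ns N \<subseteq> N \<and> card (A D Ns N) \<le> \<alpha>)"

text \<open>The state of the game is the function \<open>m\<close>, with value \<open>{}\<close> on vertices not yet presented.\<close>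

definition assign :: "(nat \<Rightarrow> nat set) \<Rightarrow> nat \<Rightarrow> nat set \<Rightarrow> nat \<Rightarrow> nat set" where
  "assign m u S = (\<lambda>x. if x = u then S else m x - S)"

primrec state_after :: "scheduler \<Rightarrow> nat set \<Rightarrow> nat set list \<Rightarrow> nat \<Rightarrow> nat \<Rightarrow> nat set" where
  "state_after A D Ns 0 = (\<lambda>_. {})"
| "state_after A D Ns (Suc k) =
     assign (state_after A D Ns k) k (A D (take k Ns) (Ns ! k))"

definition constructed_size :: "scheduler \<Rightarrow> nat set \<Rightarrow> nat set list \<Rightarrow> nat" where
  "constructed_size A D Ns =
     card {u. u < length Ns \<and> state_after A D Ns (length Ns) u \<noteq> {}}"

text \<open>
  For a lazy scheduler the sets below are nonempty and contained in \<open>{0..n}\<close>, so that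
  \<open>Min\<close> and \<open>Max\<close> are meaningful.
\<close>

definition scheduler_val :: "scheduler \<Rightarrow> nat \<Rightarrow> nat" where
  "scheduler_val A n = Min {constructed_size A D Ns | D Ns. is_game D Ns \<and> game_size Ns = n}"

definition lazy_val :: "nat \<Rightarrow> nat \<Rightarrow> nat" where
  "lazy_val \<alpha> n = Max {scheduler_val A n | A. lazy_scheduler \<alpha> A}"

definition competitive_ratio :: "(nat \<Rightarrow> nat) \<Rightarrow> ereal" where
  "competitive_ratio val = liminf (\<lambda>n. ereal (real (val n) / real n))"


section \<open>The algorithm Balanced\<close>

text \<open>Below \<open>u\<close> is the vertex being presented, so the earlier vertices are those \<open>x < u\<close>.\<close>

definition available :: "nat \<Rightarrow> nat set \<Rightarrow> (nat \<Rightarrow> nat set) \<Rightarrow> nat \<Rightarrow> bool" where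
  "available u N m d \<longleftrightarrow> d \<in> N \<and> (\<forall>x<u. m x \<noteq> {d})"

definition strongly_available :: "nat \<Rightarrow> nat set \<Rightarrow> (nat \<Rightarrow> nat set) \<Rightarrow> nat \<Rightarrow> bool" where
  "strongly_available u N m d \<longleftrightarrow> available u N m d \<and> (\<forall>x. d \<notin> m x)"

definition ready :: "nat \<Rightarrow> nat set \<Rightarrow> (nat \<Rightarrow> nat set) \<Rightarrow> nat \<Rightarrow> bool" where
  "ready u N m e \<longleftrightarrow> e \<le> u \<and> (\<exists>d\<in>m e. available u N m d)"

definition donor :: "nat \<Rightarrow> nat set \<Rightarrow> (nat \<Rightarrow> nat set) \<Rightarrow> nat \<Rightarrow> bool" where
  "donor u N m e \<longleftrightarrow> ready u N m e \<and> card (m u) + 2 \<le> card (m e)"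

definition balanced_move ::
    "nat \<Rightarrow> nat set \<Rightarrow> (nat \<Rightarrow> nat set) \<Rightarrow> (nat \<Rightarrow> nat set) \<Rightarrow> bool" where
  "balanced_move u N m m' \<longleftrightarrow>
     (\<exists>e d. donor u N m e \<and> (\<forall>e'. donor u N m e' \<longrightarrow> card (m e') \<le> card (m e)) \<and>
            d \<in> m e \<and> available u N m d \<and>
            m' = m(e := m e - {d}, u := insert d (m u)))"

definition balanced_round ::
    "nat \<Rightarrow> nat \<Rightarrow> nat set \<Rightarrow> (nat \<Rightarrow> nat set) \<Rightarrow> (nat \<Rightarrow> nat set) \<Rightarrow> bool" where
  "balanced_round \<alpha> u N m m' \<longleftrightarrow>
     (let F = {d. strongly_available u N (m(u := {})) d}
      in \<exists>S\<subseteq>F. card S = min \<alpha> (card F) \<and>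
           (balanced_move u N)\<^sup>*\<^sup>* (m(u := S)) m' \<and> (\<nexists>e. donor u N m' e))"

text \<open>
  The description of Balanced leaves some choices open. The following holds for the
  Scheduler algorithms that resolve them in an arbitrary way.
\<close>

definition is_balanced :: "nat \<Rightarrow> scheduler \<Rightarrow> bool" where
  "is_balanced \<alpha> A \<longleftrightarrow>
     (\<forall>D Ns k. is_game D Ns \<and> k < length Ns \<longrightarrow>
        balanced_round \<alpha> k (Ns ! k) (state_after A D Ns k) (state_after A D Ns (Suc k)))"

end

theory Submission
  imports Defs
begin

text \<open>
  Everything rests on a convex weight \<open>weight c\<close> of a set \<open>m u\<close> of size \<open>c\<close>: the number of failures
  (vertices \<open>u\<close> with \<open>m u = {}\<close>) that such a set is worth to Builder, where an empty set is worth
  \<open>1\<close> and an unassigned element is worth \<open>fail_ratio \<alpha>\<close>. The recursion for \<open>weight\<close> says that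
  retiring a set of size \<open>c\<close> costs Builder exactly what \<open>c\<close> rounds gain if Scheduler answers each
  with \<open>c - 1\<close> elements stolen from different sets of size \<open>c\<close>; by convexity no answer is better.
  So Builder can keep the total worth from decreasing, and at the end almost all of it consists of
  failures. Conversely, a vertex that receives \<open>s\<close> elements from Balanced steals only from sets of
  size greater than \<open>s\<close> and leaves all its neighbours in sets of size at most \<open>s + 1\<close>. Hence its
  contribution to the total worth is paid for by its partner in any given matching.
\<close>

section \<open>Weights\<close>

text \<open>The balance between retiring a set of size \<open>c\<close> and \<open>c\<close> offers
  is \<open>weight c / c = weight (c - 1) - (c - 1) * (weight c - weight (c - 1))\<close>; solved
  for \<open>weight c\<close> with \<open>c = i + 1\<close>, it is the recursion below. Similarly
  \<open>fail_ratio \<alpha> = weight \<alpha> / (1 + \<alpha>)\<close>: when unassigned elements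
  are offered, Scheduler takes \<alpha> of them and one more is retired, so
  \<open>\<alpha> + 1\<close> elements pay for one full set. All \<open>n\<close> elements start
  unassigned, so the initial worth is \<open>fail_ratio \<alpha> * n\<close>. Builder retires
  exactly one element per round. The retired elements then witness a perfect matching, so the game
  size is the number of rounds and every failure is a loss. Builder is stuck only when at most
  \<open>c * \<alpha>\<close> sets of each size \<open>c\<close> are left, so the stranded worth is
  bounded independently of \<open>n\<close>. For Balanced the obstacle is that later rounds change
  the set containing the partner of \<open>u\<close>. The size of the set containing a given element
  never rises, so the bound valid after the round of \<open>u\<close> holds at the end, where the
  worth of each set is split evenly among its elements. Vertices outside the matching may be charged
  1 each.\<close>

primrec weight :: "nat \<Rightarrow> real" where
  "weight 0 = 1"
| "weight (Suc i) = weight i * (real i + 1)\<^sup>2 / (1 + real i + (real i)\<^sup>2)"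

definition slope :: "nat \<Rightarrow> real" where
  "slope i = weight (Suc i) - weight i"

definition fail_ratio :: "nat \<Rightarrow> real" where
  "fail_ratio \<alpha> = weight \<alpha> / (1 + real \<alpha>)"

lemma denominator_pos: "0 < 1 + real i + (real i)\<^sup>2"
  by (smt (verit) of_nat_0_le_iff zero_le_power2)

lemma weight_pos: "0 < weight i"
  by (induction i) (auto intro!: divide_pos_pos mult_pos_pos denominator_pos)

lemma slope_eq: "slope i = weight i * real i / (1 + real i + (real i)\<^sup>2)"
  using denominator_pos[of i] by (simp add: slope_def field_simps power2_eq_square)

text \<open>This is the balance equation that the recursion of \<open>weight\<close> was designed to
  satisfy. The right-hand side is the intercept at 0 of the line through the points of
  \<open>weight\<close> at \<open>i\<close> and \<open>i + 1\<close>.\<close>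

lemma weight_Suc_over_Suc: "weight (Suc i) / (1 + real i) = weight i - real i * slope i"
proof -
  define p where "p = 1 + real i + (real i)\<^sup>2"
  have p: "0 < p" unfolding p_def by (rule denominator_pos)
  have "weight (Suc i) / (1 + real i) = weight i * (1 + real i) / p"
    unfolding weight.simps p_def[symmetric] by (simp add: power2_eq_square add.commute)
  also have "\<dots> = weight i - real i * (weight i * real i / p)"
    using p by (simp add: field_simps) (simp add: p_def algebra_simps power2_eq_square)
  finally show ?thesis by (simp add: slope_eq p_def)
qed

text \<open>Convexity of \<open>weight\<close>. After cancelling common factors the claim is
  \<open>(i + 1)^3 - 1 \<le> (i + 1)^3\<close>.\<close>

lemma slope_Suc: "slope i \<le> slope (Suc i)"
proof -
  let ?x = "real i"
  have p: "0 < 1 + ?x + ?x\<^sup>2" "0 < 1 + (?x + 1) + (?x + 1)\<^sup>2"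
    using denominator_pos[of i] denominator_pos[of "Suc i"] by (simp_all add: add.commute)
  have "?x / (1 + ?x + ?x\<^sup>2) \<le> (?x + 1)\<^sup>2 * (?x + 1) / ((1 + ?x + ?x\<^sup>2) * (1 + (?x + 1) + (?x + 1)\<^sup>2))"
    using p by (simp add: divide_simps) (simp add: algebra_simps power2_eq_square)
  from mult_left_mono[OF this, of "weight i"] show ?thesis
    unfolding slope_eq using weight_pos[of i] by (simp add: mult.assoc add.commute)
qed

lemma slope_mono: "i \<le> j \<Longrightarrow> slope i \<le> slope j"
  by (rule lift_Suc_mono_le[of slope]) (rule slope_Suc)

lemma weight_ge_tangent: "weight s \<ge> weight c + (real s - real c) * slope c"
proof (cases "c \<le> s")
  case True
  then show ?thesis
  proof (induction s rule: dec_induct)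
    case (step s)
    have "slope c \<le> slope s" using step by (intro slope_mono) auto
    then show ?case using step unfolding slope_def[of s] by (simp add: algebra_simps)
  qed simp
next
  case False
  then have "s \<le> c" by simp
  then show ?thesis
  proof (induction s rule: inc_induct)
    case (step s)
    have "slope s \<le> slope c" using step by (intro slope_mono) auto
    then show ?case using step unfolding slope_def[of s] by (simp add: algebra_simps)
  qed simp
qed

text \<open>By convexity the first element taken from a set costs most, namely
  \<open>slope (c - 1)\<close>. This bounds Builder's loss when one set is robbed several
  times.\<close>

lemma weight_diff_le:
  assumes "r \<le> c" "0 < c"
  shows "weight c - weight (c - r) \<le> real r * slope (c - 1)"
proof -
  have "weight c = weight (c - 1) + slope (c - 1)"
    using assms by (simp add: slope_def)
  with weight_ge_tangent[of "c - 1" "c - r"] assms show ?thesis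
    by (simp add: of_nat_diff algebra_simps)
qed

text \<open>If \<open>s\<close> elements are stolen from sets of size \<open>c\<close> at
  \<open>slope (c - 1)\<close> each, the right-hand side is what Builder gains. The tangent at
  \<open>c - 1\<close> shows that the answer \<open>s = c - 1\<close> minimises it.\<close>

lemma weight_ge_linear:
  assumes "0 < c"
  shows "weight c / real c \<le> weight s - real s * slope (c - 1)"
proof -
  have "weight c / real c = weight (c - 1) - real (c - 1) * slope (c - 1)"
    using weight_Suc_over_Suc[of "c - 1"] assms by (simp add: of_nat_diff)
  with weight_ge_tangent[of "c - 1" s] show ?thesis
    by (simp add: algebra_simps)
qed

text \<open>One step of the antitonicity of \<open>fail_ratio\<close>. After cancelling it reads
  \<open>(i + 1)^3 \<le> (i + 1)^3 + 1\<close>.\<close>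

lemma weight_over_Suc_Suc: "weight (Suc i) / (2 + real i) \<le> weight i / (1 + real i)"
proof -
  let ?x = "real i"
  have p: "0 < 1 + ?x + ?x\<^sup>2" by (rule denominator_pos)
  have "(?x + 1)\<^sup>2 / ((1 + ?x + ?x\<^sup>2) * (2 + ?x)) \<le> 1 / (1 + ?x)"
    using p by (simp add: divide_simps) (simp add: algebra_simps power2_eq_square)
  from mult_left_mono[OF this, of "weight i"] show ?thesis
    using weight_pos[of i] by (simp add: mult.assoc)
qed

lemma fail_ratio_antimono: "i \<le> j \<Longrightarrow> fail_ratio j \<le> fail_ratio i"
  by (rule lift_Suc_antimono_le[of fail_ratio])
    (use weight_over_Suc_Suc in \<open>simp_all add: fail_ratio_def add.assoc\<close>)

lemma fail_ratio_pos: "0 < fail_ratio \<alpha>"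
  unfolding fail_ratio_def using weight_pos[of \<alpha>] by (intro divide_pos_pos) auto

text \<open>Lets Balanced account for a fresh element, worth \<open>fail_ratio \<alpha>\<close>, as
  if it had been stolen at the cost \<open>slope s\<close>. By convexity only the last slope below
  \<alpha> matters.\<close>

lemma slope_le_fail_ratio:
  assumes "s < \<alpha>"
  shows "slope s \<le> fail_ratio \<alpha>"
proof -
  obtain i where i: "\<alpha> = Suc i" "s \<le> i" using assms by (cases \<alpha>) auto
  let ?x = "real i"
  have p: "0 < 1 + ?x + ?x\<^sup>2" by (rule denominator_pos)
  have "?x / (1 + ?x + ?x\<^sup>2) \<le> (?x + 1)\<^sup>2 / ((1 + ?x + ?x\<^sup>2) * (2 + ?x))"
    using p by (simp add: divide_simps) (simp add: algebra_simps power2_eq_square)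
  from mult_left_mono[OF this, of "weight i"] have "slope i \<le> fail_ratio \<alpha>"
    unfolding slope_eq fail_ratio_def i using weight_pos[of i] by (simp add: mult.assoc add.assoc)
  with slope_mono[OF i(2)] show ?thesis by simp
qed

text \<open>What a round giving \<open>s\<close> elements to its vertex can add to the total worth.
  For \<open>s < \<alpha>\<close> it is \<open>weight s - s * slope s\<close>, all elements being
  charged as stolen; for \<open>s = \<alpha>\<close> all are fresh and \<open>weight \<alpha> -
  \<alpha> * fail_ratio \<alpha> = fail_ratio \<alpha>\<close>.\<close>

definition price :: "nat \<Rightarrow> nat \<Rightarrow> real" where
  "price \<alpha> s = (if s < \<alpha> then weight (Suc s) / real (Suc s) else fail_ratio \<alpha>)"

text \<open>The quotients are intercepts of consecutive chords of \<open>weight\<close>. Two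
  neighbouring chords meet at \<open>n + 1\<close>, and by convexity the steeper one has the lower
  intercept.\<close>

lemma weight_over_Suc_antimono:
  assumes "i \<le> j"
  shows "weight (Suc j) / real (Suc j) \<le> weight (Suc i) / real (Suc i)"
proof -
  have "weight (Suc (Suc n)) / real (Suc (Suc n)) \<le> weight (Suc n) / real (Suc n)" for n
  proof -
    have "weight (Suc (Suc n)) / real (Suc (Suc n)) = weight (Suc n) - (1 + real n) * slope (Suc n)"
      using weight_Suc_over_Suc[of "Suc n"] by (simp del: weight.simps)
    also have "\<dots> \<le> weight (Suc n) - (1 + real n) * slope n"
      using slope_Suc[of n] by (simp del: weight.simps)
    also have "\<dots> = weight n - real n * slope n"
      by (simp add: slope_def algebra_simps del: weight.simps)
    also have "\<dots> = weight (Suc n) / real (Suc n)"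
      using weight_Suc_over_Suc[of n] by (simp del: weight.simps)
    finally show ?thesis .
  qed
  then show ?thesis using assms by (rule lift_Suc_antimono_le[of "\<lambda>n. weight (Suc n) / real (Suc n)"])
qed

lemma price_le_1: "price \<alpha> s \<le> 1"
proof (cases "s < \<alpha>")
  case True
  then show ?thesis using weight_over_Suc_antimono[of 0 s] by (simp add: price_def)
next
  case False
  then show ?thesis using fail_ratio_antimono[of 0 \<alpha>] by (simp add: price_def fail_ratio_def)
qed

lemma fail_ratio_le_price:
  assumes "l \<le> \<alpha>" "0 < l"
  shows "fail_ratio \<alpha> \<le> weight l / real l"
proof -
  have "fail_ratio \<alpha> \<le> fail_ratio l" using assms by (intro fail_ratio_antimono)
  also have "\<dots> \<le> weight l / real l"
    unfolding fail_ratio_def using assms weight_pos[of l] by (intro divide_left_mono) auto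
  finally show ?thesis .
qed

lemma price_le:
  assumes "l \<le> \<alpha>" "0 < l" "s < \<alpha> \<Longrightarrow> l \<le> Suc s"
  shows "price \<alpha> s \<le> weight l / real l"
proof (cases "s < \<alpha>")
  case True
  then show ?thesis using weight_over_Suc_antimono[of "l - 1" s] assms by (simp add: price_def)
next
  case False
  then show ?thesis using fail_ratio_le_price[OF assms(1,2)] by (simp add: price_def)
qed

text \<open>Each factor of the recursion is \<open>(i + 1) / i\<close> times a factor of the
  product. The quotients \<open>(i + 1) / i\<close> telescope to \<alpha>, starting from
  \<open>weight 1 = 1\<close>.\<close>

lemma fail_ratio_eq:
  assumes "1 \<le> \<alpha>"
  shows "fail_ratio \<alpha> = real \<alpha> / (1 + real \<alpha>) *
    (\<Prod>i=1..\<alpha> - 1. (real i + (real i)\<^sup>2) / (1 + real i + (real i)\<^sup>2))"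
proof -
  have "weight \<alpha> = real \<alpha> *
      (\<Prod>i=1..\<alpha> - 1. (real i + (real i)\<^sup>2) / (1 + real i + (real i)\<^sup>2))"
    using assms
  proof (induction \<alpha> rule: dec_induct)
    case (step n)
    define p where "p = 1 + real n + (real n)\<^sup>2"
    have "{1..Suc n - 1} = insert n {1..n - 1}" using step by auto
    then have "(\<Prod>i=1..Suc n - 1. (real i + (real i)\<^sup>2) / (1 + real i + (real i)\<^sup>2)) =
        (real n + (real n)\<^sup>2) / p * (\<Prod>i=1..n - 1. (real i + (real i)\<^sup>2) / (1 + real i + (real i)\<^sup>2))"
      using step by (simp add: p_def)
    moreover have "weight (Suc n) = weight n * (real n + 1)\<^sup>2 / p" by (simp add: p_def)
    ultimately show ?case
      using step.IH by (simp add: power2_eq_square algebra_simps)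
  qed simp
  then show ?thesis by (simp add: fail_ratio_def)
qed

section \<open>Balanced rounds\<close>

lemma assign_same [simp]: "assign m u S u = S"
  by (simp add: assign_def)

lemma assign_other: "x \<noteq> u \<Longrightarrow> assign m u S x = m x - S"
  by (simp add: assign_def)

locale round_start =
  fixes \<alpha> u :: nat and N :: "nat set" and m :: "nat \<Rightarrow> nat set"
  assumes finite_N: "finite N"
    and finite_m: "\<And>x. finite (m x)"
    and card_m: "\<And>x. card (m x) \<le> \<alpha>"
    and disjoint_m: "\<And>x y. x \<noteq> y \<Longrightarrow> m x \<inter> m y = {}"
    and not_presented: "\<And>x. u \<le> x \<Longrightarrow> m x = {}"
begin

definition fresh :: "nat set" where
  "fresh = {d. strongly_available u N (m(u := {})) d}"

lemma fresh_eq: "fresh = N - (\<Union>x. m x)"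
proof -
  have [simp]: "m(u := {}) = m" using not_presented[of u] by (auto simp: fun_eq_iff)
  show ?thesis unfolding fresh_def strongly_available_def available_def by auto
qed

text \<open>
  The number \<open>c\<close> is the size of the latest donor before its loss (and \<open>\<alpha> + 1\<close> when there was none).
\<close>

definition reached :: "nat set \<Rightarrow> nat \<Rightarrow> (nat \<Rightarrow> nat set) \<Rightarrow> bool" where
  "reached S c m' \<longleftrightarrow>
     (\<forall>x. x \<noteq> u \<longrightarrow> m' x = m x - m' u) \<and> S \<subseteq> m' u \<and> m' u \<subseteq> N \<and>
     card (m' u) < c \<and>
     (\<forall>e. donor u N m' e \<longrightarrow> card (m' e) \<le> c) \<and>
     (\<forall>d\<in>m' u - S. \<exists>x. d \<in> m x \<and> c \<le> card (m x)) \<and>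
     (\<Sum>x<u. weight (card (m' x))) \<le>
       (\<Sum>x<u. weight (card (m x))) - real (card (m' u - S)) * slope (c - 1)"

lemma
  assumes "reached S c m'"
  shows reached_other: "\<And>x. x \<noteq> u \<Longrightarrow> m' x = m x - m' u"
    and reached_superset: "S \<subseteq> m' u"
    and reached_subset: "m' u \<subseteq> N"
    and reached_card: "card (m' u) < c"
    and reached_donor: "\<And>e. donor u N m' e \<Longrightarrow> card (m' e) \<le> c"
    and reached_stolen: "\<And>d. d \<in> m' u \<Longrightarrow> d \<notin> S \<Longrightarrow> \<exists>x. d \<in> m x \<and> c \<le> card (m x)"
    and reached_weight: "(\<Sum>x<u. weight (card (m' x))) \<le>
       (\<Sum>x<u. weight (card (m x))) - real (card (m' u - S)) * slope (c - 1)"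
  using assms unfolding reached_def by blast+

lemma reached_start:
  assumes "S \<subseteq> fresh" "card S \<le> \<alpha>"
  shows "reached S (Suc \<alpha>) (m(u := S))"
  unfolding reached_def
proof (intro conjI allI impI ballI)
  show "(m(u := S)) x = m x - (m(u := S)) u" if "x \<noteq> u" for x
    using assms(1) that by (auto simp: fresh_eq)
  show "card ((m(u := S)) e) \<le> Suc \<alpha>" for e
    using assms(2) card_m[of e] by (cases "e = u") auto
qed (use assms in \<open>auto simp: fresh_eq\<close>)

text \<open>The donor of a move is a largest one, so its size serves as the new \<open>c\<close>. A
  move creates no donors, hence the sizes of successive donors never increase.\<close>

lemma reached_step:
  assumes r: "reached S c m'" and step: "balanced_move u N m' m''"
  shows "\<exists>c'. reached S c' m''" and "card (m'' u) = Suc (card (m' u))"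
proof -
  obtain e d where e: "donor u N m' e" "\<And>e'. donor u N m' e' \<Longrightarrow> card (m' e') \<le> card (m' e)"
    "d \<in> m' e" "available u N m' d" and m'': "m'' = m'(e := m' e - {d}, u := insert d (m' u))"
    using step unfolding balanced_move_def by blast
  have m': "m' x = m x - m' u" if "x \<noteq> u" for x
    using reached_other[OF r that] .
  have fin: "finite (m' x)" for x
  proof (cases "x = u")
    case True
    then show ?thesis using reached_subset[OF r] finite_N finite_subset by blast
  qed (simp add: m' finite_m)
  have card_e: "card (m' u) + 2 \<le> card (m' e)" using e(1) by (simp add: donor_def)
  have eu: "e < u" using e(1) card_e by (cases "e = u") (auto simp: donor_def ready_def)
  have dme: "d \<in> m e" "d \<notin> m' u" using e(3) eu m' by auto
  have dN: "d \<in> N" using e(4) by (simp add: available_def)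
  have dS: "d \<notin> S" using dme reached_superset[OF r] by auto
  have m''x: "m'' x = m' x" if "x \<noteq> u" "x \<noteq> e" for x using that by (simp add: m'')
  have m''e: "m'' e = m' e - {d}" and m''u: "m'' u = insert d (m' u)" using eu by (auto simp: m'')
  show cu: "card (m'' u) = Suc (card (m' u))" using m''u dme fin[of u] by simp
  have ce: "card (m'' e) = card (m' e) - 1" using m''e e(3) fin[of e] by simp
  have cle: "card (m' e) \<le> c" using reached_donor[OF r e(1)] .
  have "reached S (card (m' e)) m''"
    unfolding reached_def
  proof (intro conjI allI impI ballI)
    show "m'' x = m x - m'' u" if xu: "x \<noteq> u" for x
    proof (cases "x = e")
      case True
      then show ?thesis using m'[of e] eu m''e m''u by auto
    next
      case False
      then have "d \<notin> m x" using disjoint_m[of x e] dme by auto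
      with False show ?thesis using m''x[of x] m'[of x] m''u xu by auto
    qed
    show "S \<subseteq> m'' u" "m'' u \<subseteq> N" using reached_superset[OF r] reached_subset[OF r] m''u dN by auto
    show "card (m'' u) < card (m' e)" using cu card_e by simp
    show "card (m'' x) \<le> card (m' e)" if don: "donor u N m'' x" for x
    proof -
      obtain d' where d': "x \<le> u" "d' \<in> m'' x" "available u N m'' d'" "card (m'' u) + 2 \<le> card (m'' x)"
        using don unfolding donor_def ready_def by blast
      have xu: "x < u" using d' by (cases "x = u") auto
      have sub: "m'' x \<subseteq> m' x" using xu m''x[of x] m''e by (cases "x = e") auto
      then have le: "card (m'' x) \<le> card (m' x)" using fin by (intro card_mono) auto
      \<comment> \<open>An element available after the move was available before it: a singleton
        that blocked \<open>d'\<close> would by disjointness be \<open>m' x\<close> itself, which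
        has at least two elements.\<close>
      have "m' y \<noteq> {d'}" if "y < u" for y
      proof
        assume y: "m' y = {d'}"
        have "y = x"
        proof (rule ccontr)
          assume "y \<noteq> x"
          then show False using disjoint_m[of x y] y m'[of y] m'[of x] \<open>y < u\<close> xu d'(2) sub by auto
        qed
        then show False using y le d'(4) by simp
      qed
      then have "available u N m' d'" using d'(3) by (simp add: available_def)
      then have "donor u N m' x"
        using xu d' sub le cu unfolding donor_def ready_def by auto
      then show ?thesis using e(2) le by fastforce
    qed
    show "\<exists>x. d' \<in> m x \<and> card (m' e) \<le> card (m x)" if d': "d' \<in> m'' u - S" for d'
    proof (cases "d' = d")
      case True
      have "m' e \<subseteq> m e" using m'[of e] eu by blast
      then have "card (m' e) \<le> card (m e)" using finite_m by (intro card_mono)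
      then show ?thesis using True dme by blast
    next
      case False
      then obtain x where "d' \<in> m x" "c \<le> card (m x)" using reached_stolen[OF r, of d'] d' m''u by blast
      then show ?thesis using cle by (intro exI[of _ x]) auto
    qed
    let ?k = "real (card (m' u - S))"
    have "m'' u - S = insert d (m' u - S)" using m''u dS by auto
    then have k: "real (card (m'' u - S)) = ?k + 1" using dme fin[of u] by simp
    have "(\<Sum>x<u. weight (card (m'' x))) = weight (card (m'' e)) + (\<Sum>x\<in>{..<u} - {e}. weight (card (m'' x)))"
      using eu by (subst sum.remove[of _ e]) auto
    also have "(\<Sum>x\<in>{..<u} - {e}. weight (card (m'' x))) = (\<Sum>x\<in>{..<u} - {e}. weight (card (m' x)))"
      by (rule sum.cong) (auto simp: m''x)
    also have "weight (card (m'' e)) = weight (card (m' e)) - slope (card (m' e) - 1)"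
      using ce card_e by (simp add: slope_def)
    also have "weight (card (m' e)) - slope (card (m' e) - 1) + (\<Sum>x\<in>{..<u} - {e}. weight (card (m' x)))
        = (\<Sum>x<u. weight (card (m' x))) - slope (card (m' e) - 1)"
      using eu by (subst sum.remove[of "{..<u}" e]) auto
    also have "\<dots> \<le> (\<Sum>x<u. weight (card (m x))) - ?k * slope (c - 1) - slope (card (m' e) - 1)"
      using reached_weight[OF r] by simp
    \<comment> \<open>Earlier thefts were charged at \<open>slope (c - 1)\<close>; donor sizes do
      not increase, so all of them may be recharged at the slope of the current donor.\<close>
    also have "\<dots> \<le> (\<Sum>x<u. weight (card (m x))) - ?k * slope (card (m' e) - 1) - slope (card (m' e) - 1)"
      using cle by (auto intro!: mult_left_mono slope_mono)
    also have "\<dots> = (\<Sum>x<u. weight (card (m x))) - real (card (m'' u - S)) * slope (card (m' e) - 1)"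
      unfolding k by (simp add: algebra_simps)
    finally show "(\<Sum>x<u. weight (card (m'' x))) \<le>
        (\<Sum>x<u. weight (card (m x))) - real (card (m'' u - S)) * slope (card (m' e) - 1)" .
  qed
  then show "\<exists>c'. reached S c' m''" ..
qed

lemma reached_moves:
  assumes "(balanced_move u N)\<^sup>*\<^sup>* (m(u := S)) m'" "S \<subseteq> fresh" "card S \<le> \<alpha>"
  shows "\<exists>c. reached S c m'"
  using assms
proof (induction rule: rtranclp_induct)
  case base
  then show ?case using reached_start by blast
next
  case (step y z)
  then show ?case using reached_step by blast
qed

lemma finite_fresh: "finite fresh"
  using finite_N by (simp add: fresh_eq)

text \<open>The while loop terminates because every move enlarges \<open>m u\<close>, which stays
  inside the finite set \<open>N\<close>.\<close>

lemma balanced_round_exists: "\<exists>m'. balanced_round \<alpha> u N m m'"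
proof -
  have "min \<alpha> (card fresh) \<le> card fresh" by simp
  then obtain S where S: "S \<subseteq> fresh" "card S = min \<alpha> (card fresh)"
    by (metis obtain_subset_with_card_n)
  have "\<exists>m'. (balanced_move u N)\<^sup>*\<^sup>* m1 m' \<and> (\<nexists>e. donor u N m' e)"
    if "reached S c m1" for c m1
    using that
  proof (induction "card N - card (m1 u)" arbitrary: c m1 rule: less_induct)
    case less
    show ?case
    proof (cases "\<exists>e. donor u N m1 e")
      case True
      let ?C = "(\<lambda>e. card (m1 e)) ` {e. donor u N m1 e}"
      have fin: "finite ?C"
        by (rule finite_imageI, rule finite_subset[of _ "{..u}"]) (auto simp: donor_def ready_def)
      with True have "Max ?C \<in> ?C" by (intro Max_in) auto
      then obtain e where e: "donor u N m1 e" "card (m1 e) = Max ?C" by auto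
      with fin have "\<And>e'. donor u N m1 e' \<Longrightarrow> card (m1 e') \<le> card (m1 e)" by simp
      note e = e(1) this
      then obtain d where "d \<in> m1 e" "available u N m1 d"
        by (auto simp: donor_def ready_def)
      with e obtain m2 where m2: "balanced_move u N m1 m2"
        unfolding balanced_move_def by blast
      obtain c2 where c2: "reached S c2 m2" using reached_step(1)[OF less.prems m2] by blast
      have "card (m2 u) \<le> card N" using reached_subset[OF c2] finite_N by (intro card_mono)
      then have "card N - card (m2 u) < card N - card (m1 u)"
        using reached_step(2)[OF less.prems m2] by simp
      from less.hyps[OF this c2] obtain m' where
        "(balanced_move u N)\<^sup>*\<^sup>* m2 m'" "\<nexists>e. donor u N m' e" by blast
      with m2 show ?thesis by (blast intro: converse_rtranclp_into_rtranclp)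
    next
      case False
      then show ?thesis by blast
    qed
  qed
  then obtain m' where "(balanced_move u N)\<^sup>*\<^sup>* (m(u := S)) m'" "\<nexists>e. donor u N m' e"
    using reached_start[OF S(1)] S(2) by (metis min.cobounded1)
  with S show ?thesis
    unfolding balanced_round_def fresh_def[symmetric] Let_def by blast
qed

context
  fixes m'
  assumes round: "balanced_round \<alpha> u N m m'"
begin

lemma round_reached:
  obtains S c where "S \<subseteq> fresh" "card S = min \<alpha> (card fresh)" "reached S c m'" "\<nexists>e. donor u N m' e"
  using round reached_moves unfolding balanced_round_def fresh_def[symmetric] Let_def
  by (metis min.cobounded1)

lemma round_other: "x \<noteq> u \<Longrightarrow> m' x = m x - m' u"
  by (rule round_reached) (rule reached_other)

lemma round_subset: "m' u \<subseteq> N"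
  by (rule round_reached) (rule reached_subset)

lemma finite_round: "finite (m' x)"
proof (cases "x = u")
  case True
  then show ?thesis using round_subset finite_N finite_subset by blast
qed (simp add: round_other finite_m)

text \<open>The last donor, and so every earlier one, had size at least \<open>c\<close> when the
  round began, and \<open>c\<close> exceeds the final size of \<open>m' u\<close>.\<close>

lemma stolen_card:
  assumes "d \<in> m' u" "d \<in> m x"
  shows "card (m' u) < card (m x)"
proof -
  obtain S c where S: "S \<subseteq> fresh" "reached S c m'" by (rule round_reached) (rule that)
  have "d \<notin> S" using S(1) assms(2) by (auto simp: fresh_eq)
  then obtain y where y: "d \<in> m y" "c \<le> card (m y)" using reached_stolen[OF S(2) assms(1)] by blast
  have "y = x" using disjoint_m[of x y] y(1) assms(2) by auto
  then show ?thesis using reached_card[OF S(2)] y(2) by simp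
qed

lemma round_card: "card (m' u) \<le> \<alpha>"
proof (cases "\<exists>d x. d \<in> m' u \<and> d \<in> m x")
  case True
  then show ?thesis using stolen_card card_m by (meson less_imp_le less_le_trans)
next
  case False
  obtain S c where S: "S \<subseteq> fresh" "card S = min \<alpha> (card fresh)" "reached S c m'" by (rule round_reached) (rule that)
  have "m' u \<subseteq> S" using reached_stolen[OF S(3)] False by blast
  then have "card (m' u) \<le> card S" using S(1) finite_fresh by (meson card_mono finite_subset)
  then show ?thesis using S(2) by simp
qed

text \<open>If \<open>u\<close> receives fewer than \<alpha> elements, the fresh ones are exhausted,
  so every neighbour is assigned. A set of size at least \<open>card (m' u) + 2\<close> holding a
  neighbour would be a donor, contradicting the end of the loop.\<close>

lemma round_level:
  assumes "d \<in> N" "card (m' u) < \<alpha>"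
  shows "\<exists>y. d \<in> m' y \<and> card (m' y) \<le> Suc (card (m' u))"
proof -
  obtain S c where S: "S \<subseteq> fresh" "card S = min \<alpha> (card fresh)" "reached S c m'" "\<nexists>e. donor u N m' e"
    by (rule round_reached)
  have Su: "S \<subseteq> m' u" using S(3) by (rule reached_superset)
  then have "card S \<le> card (m' u)" using finite_round by (intro card_mono)
  then have "card S = card fresh" using S(2) assms(2) by simp
  then have "S = fresh" using S(1) finite_fresh by (simp add: card_subset_eq)
  have "\<exists>y. d \<in> m' y"
  proof (cases "d \<in> m' u")
    case False
    then have "d \<notin> fresh" using Su \<open>S = fresh\<close> by blast
    then obtain y where y: "d \<in> m y" using assms(1) by (auto simp: fresh_eq)
    have "y \<noteq> u" using y not_presented[of u] by auto
    then show ?thesis using y False round_other by blast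
  qed blast
  then obtain y where y: "d \<in> m' y" by blast
  have "card (m' y) \<le> Suc (card (m' u))"
  proof (rule ccontr)
    assume c: "\<not> ?thesis"
    then have "y \<noteq> u" by auto
    have "m' y \<subseteq> m y" using round_other[OF \<open>y \<noteq> u\<close>] by simp
    then have "y < u" using not_presented[of y] y by (metis empty_iff linorder_not_less subsetD)
    \<comment> \<open>Availability can fail only through a singleton, and by disjointness that
      singleton would be \<open>m' y\<close>, which is larger.\<close>
    have "m' x \<noteq> {d}" if "x < u" for x
    proof
      assume x: "m' x = {d}"
      have "m' x \<subseteq> m x" using round_other[of x] that by simp
      then have "x = y" using disjoint_m[of x y] x y \<open>m' y \<subseteq> m y\<close> by auto
      then show False using x c by auto
    qed
    then have "donor u N m' y"
      using y c \<open>y < u\<close> assms(1) by (auto simp: donor_def ready_def available_def)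
    then show False using S(4) by blast
  qed
  with y show ?thesis by blast
qed

text \<open>Write \<open>s\<close> for \<open>card (m' u)\<close>. A stolen element has lowered its
  old set by at least \<open>slope s\<close>, because \<open>s < c\<close>; a fresh one is credited
  \<open>fail_ratio \<alpha>\<close> on the right. What remains of \<open>weight s\<close> is at
  most \<open>price \<alpha> s\<close>.\<close>

lemma round_weight:
  "(\<Sum>x<Suc u. weight (card (m' x))) \<le>
   (\<Sum>x<u. weight (card (m x))) + price \<alpha> (card (m' u)) + fail_ratio \<alpha> * real (card (m' u - (\<Union>x. m x)))"
proof -
  obtain S c where S: "S \<subseteq> fresh" "reached S c m'" by (rule round_reached) (rule that)
  let ?s = "card (m' u)" and ?new = "m' u - (\<Union>x. m x)"
  have "d \<in> S" if "d \<in> ?new" for d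
    using that reached_stolen[OF S(2), of d] by auto
  moreover have "S \<subseteq> ?new" using S(1) reached_superset[OF S(2)] by (auto simp: fresh_eq)
  ultimately have new: "?new = S" by blast
  have "card S \<le> ?s" using new finite_round[of u] by (metis Diff_subset card_mono)
  have diff: "real (card (m' u - S)) = real ?s - real (card S)"
    using new finite_round[of u] \<open>card S \<le> ?s\<close>
    by (metis Diff_subset card_Diff_subset finite_subset of_nat_diff)
  have sc: "slope ?s \<le> slope (c - 1)" using reached_card[OF S(2)] by (intro slope_mono) auto
  have "(\<Sum>x<u. weight (card (m' x))) \<le>
      (\<Sum>x<u. weight (card (m x))) - real (card (m' u - S)) * slope (c - 1)"
    using S(2) by (rule reached_weight)
  also have "\<dots> \<le> (\<Sum>x<u. weight (card (m x))) - real (card (m' u - S)) * slope ?s"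
    using sc by (auto intro!: mult_left_mono)
  finally have *: "(\<Sum>x<Suc u. weight (card (m' x))) \<le>
      (\<Sum>x<u. weight (card (m x))) + weight ?s - real (card (m' u - S)) * slope ?s"
    by simp
  have "weight ?s - real (card (m' u - S)) * slope ?s \<le> price \<alpha> ?s + fail_ratio \<alpha> * real (card S)"
  proof (cases "?s < \<alpha>")
    case True
    have "price \<alpha> ?s = weight ?s - real ?s * slope ?s"
      using True weight_Suc_over_Suc[of ?s] by (simp add: price_def del: weight.simps)
    moreover have "real (card S) * slope ?s \<le> real (card S) * fail_ratio \<alpha>"
      using slope_le_fail_ratio[OF True] by (intro mult_left_mono) auto
    ultimately show ?thesis unfolding diff by (simp add: algebra_simps)
  next
    case False
    then have s: "?s = \<alpha>" using round_card by simp
    \<comment> \<open>A theft would need a set of more than \<alpha> elements, so all elements of a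
      full set are fresh.\<close>
    have "m' u \<subseteq> S"
      using stolen_card card_m s new by (metis DiffI UN_iff linorder_not_less subsetI)
    then have "m' u = S" using new by auto
    moreover have "weight \<alpha> = fail_ratio \<alpha> * (1 + real \<alpha>)" by (simp add: fail_ratio_def)
    ultimately show ?thesis using s by (simp add: price_def algebra_simps)
  qed
  with * new show ?thesis by simp
qed

end

end

section \<open>The lower bound for Balanced\<close>

lemma state_after_append:
  "k \<le> length Ns \<Longrightarrow> state_after A D (Ns @ X) k = state_after A D Ns k"
  by (induction k) (auto simp: nth_append)

lemma constructed_size_failures:
  "constructed_size A D Ns + card {u. u < length Ns \<and> state_after A D Ns (length Ns) u = {}} = length Ns"
proof -
  let ?m = "state_after A D Ns (length Ns)"
  have "{..<length Ns} = {u. u < length Ns \<and> ?m u \<noteq> {}} \<union> {u. u < length Ns \<and> ?m u = {}}"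
    by auto
  then have "card {..<length Ns} = constructed_size A D Ns + card {u. u < length Ns \<and> ?m u = {}}"
    unfolding constructed_size_def by (subst card_Un_disjoint[symmetric]) auto
  then show ?thesis by simp
qed

lemma is_game_nth: "is_game D Ns \<Longrightarrow> k < length Ns \<Longrightarrow> finite (Ns ! k)"
  unfolding is_game_def by (meson finite_subset nth_mem)

lemma (in round_start) round_start_next:
  assumes "balanced_round \<alpha> u N m m'" "finite N'"
  shows "round_start \<alpha> (Suc u) N' m'"
proof
  have other: "m' x \<subseteq> m x" if "x \<noteq> u" for x using round_other[OF assms(1) that] by blast
  show "finite N'" by fact
  show "finite (m' x)" for x by (rule finite_round[OF assms(1)])
  show "card (m' x) \<le> \<alpha>" for x
  proof (cases "x = u")
    case False
    then show ?thesis using other[OF False] card_m[of x] finite_m[of x] by (meson card_mono le_trans)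
  qed (simp add: round_card[OF assms(1)])
  show "m' x \<inter> m' y = {}" if "x \<noteq> y" for x y
    using disjoint_m[OF that] round_other[OF assms(1), of x] round_other[OF assms(1), of y] that by blast
  show "m' x = {}" if "Suc u \<le> x" for x
    using other[of x] not_presented[of x] that by auto
qed

lemma (in round_start) Union_presented: "(\<Union>x. m x) = (\<Union>x<u. m x)"
proof -
  have "x < u" if "d \<in> m x" for d x
    using that not_presented[of x] by (cases "x < u") auto
  then show ?thesis by blast
qed

lemma round_start_0: "finite N \<Longrightarrow> round_start \<alpha> 0 N (\<lambda>_. {})"
  by unfold_locales auto

section \<open>Existence of a Scheduler that follows Balanced\<close>

primrec balanced_state :: "nat \<Rightarrow> nat set list \<Rightarrow> nat \<Rightarrow> nat set" where
  "balanced_state \<alpha> [] = (\<lambda>_. {})"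
| "balanced_state \<alpha> (N # Ns) = (SOME m'. balanced_round \<alpha> (length Ns) N (balanced_state \<alpha> Ns) m')"

text \<open>The history is reversed because \<open>balanced_state\<close> recurses on a list whose
  head is the latest neighbourhood.\<close>

definition balanced_scheduler :: "nat \<Rightarrow> scheduler" where
  "balanced_scheduler \<alpha> D Ns N = balanced_state \<alpha> (N # rev Ns) (length Ns)"

lemma round_start_balanced_state:
  "\<forall>N\<in>set Ns. finite N \<Longrightarrow> finite N' \<Longrightarrow> round_start \<alpha> (length Ns) N' (balanced_state \<alpha> Ns)"
proof (induction Ns arbitrary: N')
  case Nil
  then show ?case by (simp add: round_start_0)
next
  case (Cons N Ns)
  interpret round_start \<alpha> "length Ns" N "balanced_state \<alpha> Ns"
    by (rule Cons.IH) (use Cons.prems in auto)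
  show ?case using round_start_next[OF someI_ex[OF balanced_round_exists] Cons.prems(2)] by simp
qed

text \<open>A scheduler reports only the new set. That is enough, since a balanced round alters
  every other set just by removing \<open>m' u\<close>, exactly as \<open>assign\<close> does; so
  the game state and \<open>balanced_state\<close> coincide.\<close>

lemma is_balanced_balanced_scheduler: "is_balanced \<alpha> (balanced_scheduler \<alpha>)"
  unfolding is_balanced_def
proof (intro allI impI)
  fix D Ns k
  assume "is_game D Ns \<and> k < length Ns"
  then have game: "is_game D Ns" and k: "k < length Ns" by auto
  let ?st = "state_after (balanced_scheduler \<alpha>) D Ns"
  let ?bs = "\<lambda>k. balanced_state \<alpha> (rev (take k Ns))"
  have fin: "finite N" if "N \<in> set Ns" for N
    using game that by (auto simp: is_game_def intro: finite_subset)
  have rev_take: "rev (take (Suc k) Ns) = Ns ! k # rev (take k Ns)" if "k < length Ns" for k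
    using that by (simp add: take_Suc_conv_app_nth)
  have start: "round_start \<alpha> k (Ns ! k) (?bs k)" if "k < length Ns" for k
    using round_start_balanced_state[of "rev (take k Ns)" "Ns ! k" \<alpha>] fin that
    by (auto dest: in_set_takeD)
  have round: "balanced_round \<alpha> k (Ns ! k) (?bs k) (?bs (Suc k))" if "k < length Ns" for k
    using someI_ex[OF round_start.balanced_round_exists[OF start[OF that]]] that
    by (simp add: rev_take)
  have st: "?st k = ?bs k" if "k \<le> length Ns" for k
    using that
  proof (induction k)
    case (Suc k)
    then have k: "k < length Ns" by simp
    have "?st (Suc k) = assign (?bs k) k (?bs (Suc k) k)"
      using Suc.IH k by (simp add: balanced_scheduler_def[abs_def] rev_take)
    also have "\<dots> = ?bs (Suc k)"
      using round_start.round_other[OF start[OF k] round[OF k]]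
      by (intro ext) (simp add: assign_def)
    finally show ?case .
  qed simp
  show "balanced_round \<alpha> k (Ns ! k) (?st k) (?st (Suc k))"
    using round[OF k] st[of k] st[of "Suc k"] k by simp
qed

section \<open>Whole games played by Balanced\<close>

locale balanced_game =
  fixes \<alpha> :: nat and A :: scheduler and D :: "nat set" and Ns :: "nat set list"
  assumes balanced: "is_balanced \<alpha> A" and game: "is_game D Ns"
begin

abbreviation st :: "nat \<Rightarrow> nat \<Rightarrow> nat set" where
  "st \<equiv> state_after A D Ns"

abbreviation arrival_size :: "nat \<Rightarrow> nat" where
  "arrival_size u \<equiv> card (st (Suc u) u)"

lemma balanced_round: "k < length Ns \<Longrightarrow> balanced_round \<alpha> k (Ns ! k) (st k) (st (Suc k))"
  using balanced game by (auto simp: is_balanced_def simp del: state_after.simps)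

lemma round_start_state: "k \<le> length Ns \<Longrightarrow> finite N \<Longrightarrow> round_start \<alpha> k N (st k)"
proof (induction k arbitrary: N)
  case 0
  then show ?case by (simp add: round_start_0)
next
  case (Suc k)
  then have "k < length Ns" by simp
  with Suc show ?case
    by (metis balanced_round game is_game_nth less_imp_le_nat round_start.round_start_next)
qed

lemma round_start_round: "k < length Ns \<Longrightarrow> round_start \<alpha> k (Ns ! k) (st k)"
  using round_start_state game is_game_nth by simp

lemma state_other: "k < length Ns \<Longrightarrow> x \<noteq> k \<Longrightarrow> st (Suc k) x = st k x - st (Suc k) k"
  by (rule round_start.round_other[OF round_start_round balanced_round])

lemma finite_state: "k \<le> length Ns \<Longrightarrow> finite (st k x)"
  by (rule round_start.finite_m[OF round_start_state[of k "{}"]]) auto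

text \<open>A stolen element moves to a smaller set by \<open>stolen_card\<close>; any other stays
  in a set that can only shrink. In particular an assigned element stays assigned.\<close>

lemma level_Suc:
  assumes "k < length Ns" "d \<in> st k x"
  shows "\<exists>y. d \<in> st (Suc k) y \<and> card (st (Suc k) y) \<le> card (st k x)"
proof (cases "d \<in> st (Suc k) k")
  case True
  then show ?thesis
    using round_start.stolen_card[OF round_start_round balanced_round True assms(2)] assms(1)
    by (meson less_imp_le)
next
  case False
  have "x \<noteq> k" using round_start.not_presented[OF round_start_round, of k k] assms by auto
  then have "st (Suc k) x = st k x - st (Suc k) k" by (rule state_other[OF assms(1)])
  then have "d \<in> st (Suc k) x" "st (Suc k) x \<subseteq> st k x" using False assms(2) by auto
  then show ?thesis using finite_state[of k x] assms(1) by (meson card_mono less_imp_le)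
qed

lemma level_mono:
  assumes "k \<le> l" "l \<le> length Ns" "d \<in> st k x"
  shows "\<exists>y. d \<in> st l y \<and> card (st l y) \<le> card (st k x)"
  using assms(1,2)
proof (induction l rule: dec_induct)
  case base
  then show ?case using assms(3) by blast
next
  case (step l)
  then obtain y where y: "d \<in> st l y" "card (st l y) \<le> card (st k x)" by auto
  with level_Suc[of l d y] step show ?case by (meson Suc_le_eq le_trans)
qed

text \<open>Summation of \<open>round_weight\<close>. Since assigned elements stay assigned, each is
  fresh in exactly one round, which gives the cardinality of the union.\<close>

lemma weight_bound:
  "k \<le> length Ns \<Longrightarrow> (\<Sum>x<k. weight (card (st k x))) \<le>
     (\<Sum>x<k. price \<alpha> (arrival_size x)) + fail_ratio \<alpha> * real (card (\<Union>x. st k x))"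
proof (induction k)
  case 0
  then show ?case by simp
next
  case (Suc k)
  then have k: "k < length Ns" by simp
  interpret round_start \<alpha> k "Ns ! k" "st k" by (rule round_start_round[OF k])
  let ?new = "st (Suc k) k - (\<Union>x. st k x)"
  have "(\<Union>x. st (Suc k) x) = (\<Union>x. st k x) \<union> ?new"
  proof (intro equalityI subsetI)
    fix d assume "d \<in> (\<Union>x. st (Suc k) x)"
    then obtain x where "d \<in> st (Suc k) x" by blast
    then show "d \<in> (\<Union>x. st k x) \<union> ?new"
      using state_other[OF k, of x] by (cases "x = k") (auto simp del: state_after.simps)
  next
    fix d assume "d \<in> (\<Union>x. st k x) \<union> ?new"
    then show "d \<in> (\<Union>x. st (Suc k) x)"
      using level_Suc[OF k] by (auto simp del: state_after.simps)
  qed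
  moreover have "finite (\<Union>x. st k x)"
    unfolding Union_presented using finite_m by simp
  moreover have "finite ?new" using finite_state[of "Suc k" k] Suc.prems by (simp del: state_after.simps)
  ultimately have card: "card (\<Union>x. st (Suc k) x) = card (\<Union>x. st k x) + card ?new"
    by (metis Diff_disjoint card_Un_disjoint)
  have "(\<Sum>x<Suc k. weight (card (st (Suc k) x))) \<le> (\<Sum>x<k. weight (card (st k x))) +
      price \<alpha> (arrival_size k) + fail_ratio \<alpha> * real (card ?new)"
    by (rule round_weight[OF balanced_round[OF k]])
  also have "\<dots> \<le> (\<Sum>x<k. price \<alpha> (arrival_size x)) + fail_ratio \<alpha> * real (card (\<Union>x. st k x)) +
      price \<alpha> (arrival_size k) + fail_ratio \<alpha> * real (card ?new)"
    using Suc by (simp del: state_after.simps)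
  also have "\<dots> = (\<Sum>x<Suc k. price \<alpha> (arrival_size x)) +
      fail_ratio \<alpha> * real (card (\<Union>x. st (Suc k) x))"
    unfolding card by (simp add: algebra_simps del: state_after.simps)
  finally show ?case .
qed

text \<open>The worth at the end is failures plus the shares \<psi> of the elements, and it is at
  most the sum of the prices plus \<open>?r\<close> per assigned element. A matched vertex is paid
  for by its partner's share, any other costs at most 1.\<close>

lemma constructed_size_ge:
  assumes "is_matching (game_edges Ns) M"
  shows "(1 - fail_ratio \<alpha>) * real (card M) \<le> real (constructed_size A D Ns)"
proof -
  let ?L = "length Ns" and ?m = "st (length Ns)" and ?r = "fail_ratio \<alpha>"
  define P where "P = (\<Union>x. ?m x)"
  \<comment> \<open>The share of an assigned element in the weight of its set. The value
    \<open>?r\<close> off \<open>P\<close> makes \<open>\<psi> d - ?r\<close> vanish there and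
    equals the price of a vertex with a full set.\<close>
  define \<psi> where "\<psi> d = (if d \<in> P then weight (card (?m (THE x. d \<in> ?m x))) / real (card (?m (THE x. d \<in> ?m x)))
    else ?r)" for d
  interpret fin: round_start \<alpha> ?L "{}" ?m by (rule round_start_state) auto
  have \<psi>: "\<psi> d = weight (card (?m x)) / real (card (?m x))" if "d \<in> ?m x" for d x
  proof -
    have "(THE x. d \<in> ?m x) = x" using that fin.disjoint_m by (intro the_equality) blast+
    then show ?thesis using that by (auto simp: \<psi>_def P_def)
  qed
  have \<psi>_ge: "?r \<le> \<psi> d" for d
  proof (cases "d \<in> P")
    case True
    then obtain x where x: "d \<in> ?m x" by (auto simp: P_def)
    then have "0 < card (?m x)" using fin.finite_m by (auto simp: card_gt_0_iff)
    with \<psi>[OF x] show ?thesis using fail_ratio_le_price[OF fin.card_m] by simp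
  qed (simp add: \<psi>_def)
  \<comment> \<open>For an assigned \<open>d\<close>, \<open>round_level\<close> bounds its set
    after the round of \<open>u\<close> and \<open>level_mono\<close> carries the bound to the end.
    If \<open>d\<close> is unassigned at the end, \<open>u\<close> must have received a full
    set.\<close>
  have matched: "price \<alpha> (arrival_size u) \<le> \<psi> d" if "(u, d) \<in> M" for u d
  proof (cases "d \<in> P")
    case True
    have ud: "u < ?L" "d \<in> Ns ! u"
      using assms that by (auto simp: is_matching_def game_edges_def)
    obtain x where x: "d \<in> ?m x" using True by (auto simp: P_def)
    have "card (?m x) \<le> Suc (arrival_size u)" if s: "arrival_size u < \<alpha>"
    proof -
      obtain y where y: "d \<in> st (Suc u) y" "card (st (Suc u) y) \<le> Suc (arrival_size u)"
        using round_start.round_level[OF round_start_round[OF ud(1)] balanced_round[OF ud(1)] ud(2) s]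
        by blast
      obtain z where z: "d \<in> ?m z" "card (?m z) \<le> card (st (Suc u) y)"
        using level_mono[of "Suc u" ?L d y] ud y(1) by auto
      have "z = x" using z(1) x fin.disjoint_m by blast
      with z y show ?thesis by simp
    qed
    then show ?thesis
      unfolding \<psi>[OF x] using x fin.card_m fin.finite_m by (intro price_le) (auto simp: card_gt_0_iff)
  next
    case False
    have ud: "u < ?L" "d \<in> Ns ! u"
      using assms that by (auto simp: is_matching_def game_edges_def)
    have "\<not> arrival_size u < \<alpha>"
    proof
      assume s: "arrival_size u < \<alpha>"
      obtain y where y: "d \<in> st (Suc u) y"
        using round_start.round_level[OF round_start_round[OF ud(1)] balanced_round[OF ud(1)] ud(2) s]
        by blast
      then show False
        using level_mono[of "Suc u" ?L d y] ud False by (auto simp: P_def)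
    qed
    then show ?thesis using False by (simp add: price_def \<psi>_def)
  qed
  have inj: "inj_on fst M" "inj_on snd M"
    using assms unfolding is_matching_def inj_on_def by blast+
  have fst_M: "fst ` M \<subseteq> {..<?L}"
    using assms by (auto simp: is_matching_def game_edges_def)
  then have finM: "finite M" using inj(1) finite_imageD finite_subset by blast
  have P_eq: "P = (\<Union>x<?L. ?m x)"
    unfolding P_def by (rule fin.Union_presented)
  then have finP: "finite P" using fin.finite_m by simp
  let ?F = "{u. u < ?L \<and> ?m u = {}}"
  have *: "weight (card (?m u)) = (if ?m u = {} then 1 else 0) + (\<Sum>d\<in>?m u. \<psi> d)" for u
  proof (cases "?m u = {}")
    case False
    then have "card (?m u) \<noteq> 0" using fin.finite_m by simp
    moreover have "(\<Sum>d\<in>?m u. \<psi> d) = (\<Sum>d\<in>?m u. weight (card (?m u)) / real (card (?m u)))"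
      by (rule sum.cong) (auto simp: \<psi>)
    ultimately show ?thesis using False by simp
  qed simp
  have "(\<Sum>u<?L. weight (card (?m u))) = (\<Sum>u<?L. if ?m u = {} then 1 else 0) + (\<Sum>u<?L. \<Sum>d\<in>?m u. \<psi> d)"
    unfolding * sum.distrib ..
  also have "(\<Sum>u<?L. \<Sum>d\<in>?m u. \<psi> d) = sum \<psi> P"
    unfolding P_eq using fin.finite_m fin.disjoint_m by (intro sum.UNION_disjoint[symmetric]) auto
  also have "(\<Sum>u<?L. if ?m u = {} then 1 else 0) = real (card ?F)"
  proof -
    have "?F = {u \<in> {..<?L}. ?m u = {}}" by auto
    then show ?thesis by (simp add: sum.If_cases Int_def)
  qed
  finally have total: "real (card ?F) + sum \<psi> P \<le>
      (\<Sum>u<?L. price \<alpha> (arrival_size u)) + ?r * real (card P)"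
    using weight_bound[of ?L] by (simp add: P_def)
  have "(\<Sum>u<?L. price \<alpha> (arrival_size u)) =
      (\<Sum>u\<in>{..<?L} - fst ` M. price \<alpha> (arrival_size u)) + (\<Sum>u\<in>fst ` M. price \<alpha> (arrival_size u))"
    using fst_M by (intro sum.subset_diff) auto
  also have "(\<Sum>u\<in>{..<?L} - fst ` M. price \<alpha> (arrival_size u)) \<le> (\<Sum>u\<in>{..<?L} - fst ` M. 1)"
    by (intro sum_mono price_le_1)
  also have "(\<Sum>u\<in>{..<?L} - fst ` M. 1) = real ?L - real (card M)"
    using fst_M card_image[OF inj(1)] card_mono[OF _ fst_M]
    by (simp add: card_Diff_subset finite_subset[OF fst_M] of_nat_diff)
  also have "(\<Sum>u\<in>fst ` M. price \<alpha> (arrival_size u)) = (\<Sum>e\<in>M. price \<alpha> (arrival_size (fst e)))"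
    by (simp add: sum.reindex[OF inj(1)] del: state_after.simps)
  also have "\<dots> \<le> (\<Sum>e\<in>M. \<psi> (snd e))"
    using matched by (intro sum_mono) auto
  also have "\<dots> = sum \<psi> (snd ` M)" by (simp add: sum.reindex[OF inj(2)])
  also have "\<dots> = (\<Sum>d\<in>snd ` M. \<psi> d - ?r) + ?r * real (card M)"
    by (simp add: sum_subtractf card_image[OF inj(2)])
  \<comment> \<open>Comparing shares with \<open>?r\<close> gives nonnegative terms, so the matched
    elements can be replaced by all of \<open>P\<close>; this cancels against the shares in
    \<open>total\<close>.\<close>
  also have "(\<Sum>d\<in>snd ` M. \<psi> d - ?r) = (\<Sum>d\<in>snd ` M \<inter> P. \<psi> d - ?r)"
    using finM by (intro sum.mono_neutral_right) (auto simp: \<psi>_def)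
  also have "\<dots> \<le> (\<Sum>d\<in>P. \<psi> d - ?r)"
    using finP \<psi>_ge by (intro sum_mono2) auto
  also have "\<dots> = sum \<psi> P - ?r * real (card P)"
    by (simp add: sum_subtractf)
  finally have "real (card ?F) \<le> real ?L - real (card M) + ?r * real (card M)"
    using total by simp
  moreover have "real (constructed_size A D Ns) = real ?L - real (card ?F)"
    using constructed_size_failures[of A D Ns] by linarith
  ultimately show ?thesis by (simp add: algebra_simps)
qed

end

section \<open>Builder\<close>

lemma card_matching_le_length:
  assumes "is_matching (game_edges Ns) M"
  shows "card M \<le> length Ns"
proof -
  have inj: "inj_on fst M" using assms unfolding is_matching_def inj_on_def by blast
  have sub: "fst ` M \<subseteq> {..<length Ns}"
    using assms by (auto simp: is_matching_def game_edges_def)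
  show ?thesis using card_inj_on_le[OF inj sub] by simp
qed

lemma finite_matching_sizes: "finite {card M | M. is_matching (game_edges Ns) M}"
  by (rule finite_subset[of _ "{..length Ns}"]) (auto dest: card_matching_le_length)

lemma card_matching_le_game_size: "is_matching (game_edges Ns) M \<Longrightarrow> card M \<le> game_size Ns"
  unfolding game_size_def by (rule Max_ge[OF finite_matching_sizes]) auto

lemma maximum_matching:
  obtains M where "is_matching (game_edges Ns) M" "card M = game_size Ns"
proof -
  have "is_matching (game_edges Ns) {}" by (simp add: is_matching_def)
  then have "game_size Ns \<in> {card M | M. is_matching (game_edges Ns) M}"
    unfolding game_size_def by (intro Max_in[OF finite_matching_sizes]) auto
  with that show ?thesis by auto
qed

text \<open>A perfect matching of the presented vertices onto the retired elements, which pins the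
  game size to the number of rounds.\<close>

definition saturating :: "nat set list \<Rightarrow> nat set \<Rightarrow> bool" where
  "saturating Ns R \<longleftrightarrow> (\<exists>f. bij_betw f {..<length Ns} R \<and> (\<forall>u<length Ns. f u \<in> Ns ! u))"

lemma saturating_Nil: "saturating [] {}"
  by (auto simp: saturating_def bij_betw_def)

lemma saturating_card: "saturating Ns R \<Longrightarrow> card R = length Ns"
  by (auto simp: saturating_def dest: bij_betw_same_card)

text \<open>All neighbourhoods in \<open>X\<close> contain all of \<open>E\<close>, so any bijection
  extends the matching.\<close>

lemma saturating_append:
  assumes "saturating Ns R" "finite E" "card E = length X" "R \<inter> E = {}" "\<forall>N\<in>set X. E \<subseteq> N"
  shows "saturating (Ns @ X) (R \<union> E)"
proof -
  let ?L = "length Ns" and ?J = "{length Ns..<length Ns + length X}"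
  obtain f where f: "bij_betw f {..<?L} R" "\<forall>u<?L. f u \<in> Ns ! u"
    using assms(1) by (auto simp: saturating_def)
  obtain g where g: "bij_betw g ?J E"
    using finite_same_card_bij[of ?J E] assms(2,3) by auto
  define h where "h u = (if u < ?L then f u else g u)" for u
  have "bij_betw h {..<?L} R"
    using f(1) by (rule bij_betw_cong[THEN iffD1, rotated]) (simp add: h_def)
  moreover have "bij_betw h ?J E"
    using g by (rule bij_betw_cong[THEN iffD1, rotated]) (simp add: h_def)
  ultimately have "bij_betw h ({..<?L} \<union> ?J) (R \<union> E)"
    using assms(4) by (rule bij_betw_combine)
  moreover have "{..<?L} \<union> ?J = {..<length (Ns @ X)}" by auto
  moreover have "h u \<in> (Ns @ X) ! u" if "u < length (Ns @ X)" for u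
  proof (cases "u < ?L")
    case False
    then have "g u \<in> E" using g that by (auto simp: bij_betw_def)
    moreover have "X ! (u - ?L) \<in> set X" using False that by (intro nth_mem) auto
    ultimately show ?thesis using False assms(5) by (auto simp: h_def nth_append)
  qed (use f in \<open>auto simp: h_def nth_append\<close>)
  ultimately show ?thesis unfolding saturating_def by auto
qed

lemma game_size_saturating:
  assumes "saturating Ns R"
  shows "game_size Ns = length Ns"
proof (rule antisym)
  obtain f where f: "bij_betw f {..<length Ns} R" "\<forall>u<length Ns. f u \<in> Ns ! u"
    using assms by (auto simp: saturating_def)
  let ?M = "(\<lambda>u. (u, f u)) ` {..<length Ns}"
  have "is_matching (game_edges Ns) ?M"
    using f by (auto simp: is_matching_def game_edges_def bij_betw_def inj_on_def)
  moreover have "card ?M = length Ns" by (subst card_image) (auto simp: inj_on_def)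
  ultimately show "length Ns \<le> game_size Ns" using card_matching_le_game_size by metis
  show "game_size Ns \<le> length Ns" by (metis card_matching_le_length maximum_matching)
qed

lemma lazy_state:
  assumes lazy: "lazy_scheduler \<alpha> A" and game: "is_game D Ns" and k: "k \<le> length Ns"
  defines "m \<equiv> state_after A D Ns k"
  shows "m x \<subseteq> (if x < k then Ns ! x else {}) \<and> card (m x) \<le> \<alpha> \<and> (x \<noteq> y \<longrightarrow> m x \<inter> m y = {})"
  using k unfolding m_def
proof (induction k arbitrary: x y)
  case (Suc k)
  then have k: "k < length Ns" by simp
  let ?m = "state_after A D Ns k" and ?S = "A D (take k Ns) (Ns ! k)"
  have IH: "?m x \<subseteq> (if x < k then Ns ! x else {})" "card (?m x) \<le> \<alpha>" "x \<noteq> y \<Longrightarrow> ?m x \<inter> ?m y = {}" for x y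
    using Suc.IH[of x y] k by auto
  have "is_game D (take k Ns @ [Ns ! k])"
    using game k by (auto simp: is_game_def dest: in_set_takeD)
  then have S: "?S \<subseteq> Ns ! k" "card ?S \<le> \<alpha>"
    using lazy by (auto simp: lazy_scheduler_def)
  have fin: "finite (?m x)" for x
    using IH(1)[of x] is_game_nth[OF game, of x] k by (cases "x < k") (auto intro: finite_subset)
  have m': "state_after A D Ns (Suc k) x = (if x = k then ?S else ?m x - ?S)" for x
    by (simp add: assign_def)
  show ?case
    unfolding m'
  proof (intro conjI impI)
    show "(if x = k then ?S else ?m x - ?S) \<subseteq> (if x < Suc k then Ns ! x else {})"
      using S(1) IH(1)[of x] by (auto split: if_splits)
    have "card (?m x - ?S) \<le> \<alpha>"
      using card_mono[OF fin[of x], of "?m x - ?S"] IH(2)[of x] by auto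
    then show "card (if x = k then ?S else ?m x - ?S) \<le> \<alpha>" using S(2) by simp
    assume "x \<noteq> y"
    then show "(if x = k then ?S else ?m x - ?S) \<inter> (if y = k then ?S else ?m y - ?S) = {}"
      using IH(3)[of x y] by auto
  qed
qed simp

text \<open>The sets \<open>m u\<close> are disjoint, so picking one element from each nonempty one
  yields a matching.\<close>

lemma constructed_size_le_game_size:
  assumes "lazy_scheduler \<alpha> A" "is_game D Ns"
  shows "constructed_size A D Ns \<le> game_size Ns"
proof -
  let ?m = "state_after A D Ns (length Ns)"
  define U where "U = {u. u < length Ns \<and> ?m u \<noteq> {}}"
  note m = lazy_state[OF assms order_refl]
  have "\<forall>u\<in>U. \<exists>d. d \<in> ?m u" unfolding U_def by blast
  then obtain g where g: "\<And>u. u \<in> U \<Longrightarrow> g u \<in> ?m u" by metis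
  have "g u \<in> Ns ! u" "u < length Ns" if "u \<in> U" for u
  proof -
    show u: "u < length Ns" using that by (simp add: U_def)
    have "?m u \<subseteq> Ns ! u" using m[of u u] u by simp
    then show "g u \<in> Ns ! u" using g[OF that] by blast
  qed
  moreover have "g u \<noteq> g v" if "u \<in> U" "v \<in> U" "u \<noteq> v" for u v
  proof -
    have "?m u \<inter> ?m v = {}" using m[of u v] that(3) by blast
    then show ?thesis using g[OF that(1)] g[OF that(2)] by auto
  qed
  ultimately have "is_matching (game_edges Ns) ((\<lambda>u. (u, g u)) ` U)"
    by (auto simp: is_matching_def game_edges_def)
  moreover have "card ((\<lambda>u. (u, g u)) ` U) = card U" by (rule card_image) (simp add: inj_on_def)
  ultimately show ?thesis
    unfolding constructed_size_def U_def[symmetric] using card_matching_le_game_size by metis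
qed

section \<open>Builder's strategy against a fixed Scheduler\<close>

locale adversary =
  fixes \<alpha> n :: nat and A :: scheduler
  assumes lazy: "lazy_scheduler \<alpha> A"
begin

abbreviation state :: "nat set list \<Rightarrow> nat \<Rightarrow> nat set" where
  "state Ns \<equiv> state_after A {..<n} Ns (length Ns)"

abbreviation legal :: "nat set list \<Rightarrow> bool" where
  "legal \<equiv> is_game {..<n}"

lemma state_snoc: "state (Ns @ [N]) = assign (state Ns) (length Ns) (A {..<n} Ns N)"
  by (simp add: state_after_append)

lemma legal_snoc: "legal (Ns @ [N]) \<longleftrightarrow> legal Ns \<and> N \<subseteq> {..<n}"
  by (auto simp: is_game_def)

lemma choice:
  assumes "legal (Ns @ [N])"
  shows "A {..<n} Ns N \<subseteq> N" "card (A {..<n} Ns N) \<le> \<alpha>"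
  using lazy assms by (auto simp: lazy_scheduler_def)

lemma state_invariants:
  assumes "legal Ns"
  shows "state Ns x \<subseteq> {..<n}" "card (state Ns x) \<le> \<alpha>"
    "length Ns \<le> x \<Longrightarrow> state Ns x = {}" "x \<noteq> y \<Longrightarrow> state Ns x \<inter> state Ns y = {}"
proof -
  note inv = lazy_state[OF lazy assms order_refl, of x y]
  have "Ns ! x \<subseteq> {..<n}" if "x < length Ns" using assms that by (simp add: is_game_def)
  then show "state Ns x \<subseteq> {..<n}" using inv by (cases "x < length Ns") auto
  show "card (state Ns x) \<le> \<alpha>" "length Ns \<le> x \<Longrightarrow> state Ns x = {}" "x \<noteq> y \<Longrightarrow> state Ns x \<inter> state Ns y = {}"
    using inv by auto
qed

lemma finite_state: "legal Ns \<Longrightarrow> finite (state Ns x)"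
  using state_invariants(1) finite_subset by blast

text \<open>
  Builder keeps a set \<open>R\<close> of retired elements, which are not offered any more. The elements of
  a set \<open>m u\<close> are retired together, so that \<open>m u\<close> is then safe from Scheduler.
\<close>

definition clean :: "nat set list \<Rightarrow> nat set \<Rightarrow> bool" where
  "clean Ns R \<longleftrightarrow> (\<forall>x. state Ns x \<inter> R = {} \<or> state Ns x \<subseteq> R)"

definition unassigned :: "nat set list \<Rightarrow> nat set \<Rightarrow> nat set" where
  "unassigned Ns R = {..<n} - R - (\<Union>x. state Ns x)"

text \<open>An empty set is disjoint from \<open>R\<close>, so a failure keeps contributing
  \<open>weight 0 = 1\<close> whatever is retired.\<close>

definition active_weight :: "nat set list \<Rightarrow> nat set \<Rightarrow> nat \<Rightarrow> real" where
  "active_weight Ns R u = (if state Ns u \<inter> R = {} then weight (card (state Ns u)) else 0)"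

definition potential :: "nat set list \<Rightarrow> nat set \<Rightarrow> real" where
  "potential Ns R = (\<Sum>u<length Ns. active_weight Ns R u) +
     fail_ratio \<alpha> * real (card (unassigned Ns R))"

definition active :: "nat set list \<Rightarrow> nat set \<Rightarrow> nat \<Rightarrow> nat set" where
  "active Ns R c = {u. u < length Ns \<and> state Ns u \<inter> R = {} \<and> card (state Ns u) = c}"

text \<open>Only sets of size \<open>c\<close> are robbed, at \<open>slope (c - 1)\<close> or less
  per element, while the new vertex adds \<open>weight (card S)\<close>;
  \<open>weight_ge_linear\<close> bounds the difference for every answer \<open>S\<close>. No
  unassigned element is touched.\<close>

lemma offer_assigned:
  assumes legal: "legal Ns" and clean: "clean Ns R" and T: "T \<subseteq> active Ns R c" and c: "0 < c"
  defines "N \<equiv> \<Union>u\<in>T. state Ns u"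
  shows "legal (Ns @ [N])" "clean (Ns @ [N]) R"
    "potential Ns R + weight c / real c \<le> potential (Ns @ [N]) R"
    "\<exists>T'\<subseteq>T. card T \<le> card T' + \<alpha> \<and> (\<forall>u\<in>T'. state (Ns @ [N]) u = state Ns u)"
proof -
  let ?L = "length Ns" and ?m = "state Ns" and ?m' = "state (Ns @ [N])"
  define S where "S = A {..<n} Ns N"
  note inv = state_invariants[OF legal]
  have fin: "finite (?m x)" for x by (rule finite_state[OF legal])
  show legal': "legal (Ns @ [N])"
    using legal inv(1) by (auto simp: legal_snoc N_def)
  have S: "S \<subseteq> N" "card S \<le> \<alpha>" using choice[OF legal'] by (auto simp: S_def)
  have T_D: "T \<subseteq> {..<?L}" "\<And>u. u \<in> T \<Longrightarrow> ?m u \<inter> R = {}" "\<And>u. u \<in> T \<Longrightarrow> card (?m u) = c"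
    using T by (auto simp: active_def)
  have NR: "N \<inter> R = {}" using T_D(2) by (auto simp: N_def)
  have finT: "finite T" using T_D(1) finite_subset by blast
  then have finS: "finite S" using S(1) fin unfolding N_def by (meson finite_UN_I finite_subset)
  have m'L: "?m' ?L = S" and m': "\<And>x. x \<noteq> ?L \<Longrightarrow> ?m' x = ?m x - S"
    unfolding state_snoc S_def by (simp_all add: assign_other)
  show "clean (Ns @ [N]) R"
    unfolding clean_def
  proof
    fix x
    show "?m' x \<inter> R = {} \<or> ?m' x \<subseteq> R"
    proof (cases "x = ?L")
      case False
      with clean m'[of x] show ?thesis unfolding clean_def by blast
    qed (use m'L S(1) NR in blast)
  qed
  have outside: "?m u \<inter> S = {}" if "u \<notin> T" for u
  proof -
    have "?m u \<inter> ?m v = {}" if "v \<in> T" for v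
      using \<open>u \<notin> T\<close> that by (intro inv(4)) auto
    then show ?thesis using S(1) unfolding N_def by blast
  qed
  have union: "(\<Union>x. ?m' x) = (\<Union>x. ?m x)"
  proof (intro equalityI subsetI)
    fix d assume "d \<in> (\<Union>x. ?m' x)"
    then obtain x where "d \<in> ?m' x" by blast
    then have "d \<in> ?m x \<or> d \<in> N" using m'[of x] m'L S(1) by (cases "x = ?L") blast+
    then show "d \<in> (\<Union>x. ?m x)" unfolding N_def by blast
  next
    fix d assume "d \<in> (\<Union>x. ?m x)"
    then obtain x where x: "d \<in> ?m x" by blast
    then have "x \<noteq> ?L" using inv(3)[of ?L] by auto
    then have "d \<in> ?m' x \<or> d \<in> ?m' ?L" using x m'L m'[of x] by simp
    then show "d \<in> (\<Union>x. ?m' x)" by blast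
  qed
  have "active_weight Ns R u - real (card (?m u \<inter> S)) * slope (c - 1) \<le> active_weight (Ns @ [N]) R u"
    if "u < ?L" for u
  proof (cases "u \<in> T")
    case True
    have "card (?m u - S) = c - card (?m u \<inter> S)"
      using fin T_D(3)[OF True] by (simp add: card_Diff_subset_Int)
    moreover have "card (?m u \<inter> S) \<le> c"
      using fin T_D(3)[OF True] by (metis Int_lower1 card_mono)
    ultimately show ?thesis
      using weight_diff_le[of "card (?m u \<inter> S)" c] c T_D[of] True m'[of u] that
      unfolding active_weight_def by (auto simp: Diff_Int_distrib2)
  next
    case False
    then have "?m' u = ?m u" using m'[of u] outside[of u] that by auto
    with outside[OF False] show ?thesis unfolding active_weight_def by simp
  qed
  then have "(\<Sum>u<?L. active_weight Ns R u - real (card (?m u \<inter> S)) * slope (c - 1)) \<le>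
      (\<Sum>u<?L. active_weight (Ns @ [N]) R u)"
    by (intro sum_mono) auto
  moreover have "(\<Sum>u<?L. real (card (?m u \<inter> S))) = real (card S)"
  proof -
    have "S = (\<Union>u<?L. ?m u \<inter> S)" using S(1) T_D(1) unfolding N_def by blast
    moreover have "card (\<Union>u<?L. ?m u \<inter> S) = (\<Sum>u<?L. card (?m u \<inter> S))"
    proof (rule card_UN_disjoint)
      show "\<forall>u\<in>{..<?L}. \<forall>v\<in>{..<?L}. u \<noteq> v \<longrightarrow> ?m u \<inter> S \<inter> (?m v \<inter> S) = {}"
        using inv(4) by fastforce
    qed (use fin in auto)
    ultimately show ?thesis by simp
  qed
  moreover have "active_weight (Ns @ [N]) R ?L = weight (card S)"
    unfolding active_weight_def m'L using S(1) NR by auto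
  moreover have "unassigned (Ns @ [N]) R = unassigned Ns R"
    unfolding unassigned_def union ..
  ultimately have "potential Ns R + (weight (card S) - real (card S) * slope (c - 1)) \<le> potential (Ns @ [N]) R"
    unfolding potential_def by (simp add: sum_subtractf sum_distrib_right[symmetric])
  with weight_ge_linear[OF c, of "card S"]
  show "potential Ns R + weight c / real c \<le> potential (Ns @ [N]) R" by linarith
  \<comment> \<open>Each robbed set contains an element of \<open>S\<close> and the sets are
    disjoint, so at most \<alpha> of them are robbed.\<close>
  let ?T' = "{u \<in> T. ?m u \<inter> S = {}}"
  have "card (T - ?T') \<le> card S"
  proof -
    have "\<forall>u\<in>T - ?T'. \<exists>d. d \<in> ?m u \<inter> S" by auto
    then obtain g where g: "\<And>u. u \<in> T - ?T' \<Longrightarrow> g u \<in> ?m u \<inter> S" by metis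
    have "inj_on g (T - ?T')"
    proof (rule inj_onI)
      fix u v assume "u \<in> T - ?T'" "v \<in> T - ?T'" "g u = g v"
      then have "g u \<in> ?m u \<inter> ?m v" using g[of u] g[of v] by auto
      then show "u = v" using inv(4)[of u v] by auto
    qed
    then show ?thesis using g finS by (intro card_inj_on_le[of g]) auto
  qed
  moreover have "card T = card ?T' + card (T - ?T')"
    using finT by (metis (no_types, lifting) Diff_partition Diff_disjoint card_Un_disjoint
      finite_Diff finite_subset mem_Collect_eq subsetI)
  moreover have "?m' u = ?m u" if "u \<in> ?T'" for u
    using that T_D(1) m'[of u] by auto
  ultimately show "\<exists>T'\<subseteq>T. card T \<le> card T' + \<alpha> \<and> (\<forall>u\<in>T'. ?m' u = ?m u)"
    using S(2) by (intro exI[of _ ?T']) auto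
qed

text \<open>Each offer consists of the sets that no earlier offer has touched, so the final
  survivors lie in all \<open>j\<close> neighbourhoods and can be matched to any of these
  vertices.\<close>

lemma batch:
  assumes legal: "legal Ns" and clean: "clean Ns R" and T: "T \<subseteq> active Ns R c" and c: "0 < c"
  shows "\<exists>X T'. length X = j \<and> legal (Ns @ X) \<and> clean (Ns @ X) R \<and>
    potential Ns R + real j * (weight c / real c) \<le> potential (Ns @ X) R \<and>
    T' \<subseteq> T \<and> card T \<le> card T' + j * \<alpha> \<and> (\<forall>u\<in>T'. state (Ns @ X) u = state Ns u) \<and>
    (\<forall>N\<in>set X. \<forall>u\<in>T'. state Ns u \<subseteq> N)"
proof (induction j)
  case 0
  show ?case using legal clean by (intro exI[of _ "[]"] exI[of _ T]) auto
next
  case (Suc j)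
  then obtain X T1 where X: "length X = j" "legal (Ns @ X)" "clean (Ns @ X) R"
    "potential Ns R + real j * (weight c / real c) \<le> potential (Ns @ X) R"
    "T1 \<subseteq> T" "card T \<le> card T1 + j * \<alpha>" "\<forall>u\<in>T1. state (Ns @ X) u = state Ns u"
    "\<forall>N\<in>set X. \<forall>u\<in>T1. state Ns u \<subseteq> N" by blast
  have T1: "T1 \<subseteq> active (Ns @ X) R c"
    using X(5,7) T unfolding active_def by fastforce
  define N where "N = (\<Union>u\<in>T1. state (Ns @ X) u)"
  note offer = offer_assigned[OF X(2,3) T1 c, folded N_def]
  obtain T2 where T2: "T2 \<subseteq> T1" "card T1 \<le> card T2 + \<alpha>"
    "\<forall>u\<in>T2. state ((Ns @ X) @ [N]) u = state (Ns @ X) u" using offer(4) by blast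
  have "state Ns u \<subseteq> N'" if "u \<in> T2" "N' \<in> set (X @ [N])" for u N'
  proof (cases "N' \<in> set X")
    case False
    have "state (Ns @ X) u = state Ns u" using X(7) T2(1) that(1) by blast
    then show ?thesis using that T2(1) False unfolding N_def by auto
  qed (use X(8) T2(1) that(1) in blast)
  moreover have "potential Ns R + real (Suc j) * (weight c / real c) \<le> potential (Ns @ X @ [N]) R"
    using X(4) offer(3) by (simp add: distrib_right add_divide_distrib)
  moreover have "state (Ns @ X @ [N]) u = state Ns u" if "u \<in> T2" for u
    using X(7) T2(1,3) that by (metis append_assoc subsetD)
  moreover have "card T \<le> card T2 + Suc j * \<alpha>" using X(6) T2(2) by simp
  moreover have "T2 \<subseteq> T" using T2(1) X(5) by blast
  ultimately show ?case
    using X(1) offer(1,2) by (intro exI[of _ "X @ [N]"] exI[of _ T2]) (simp del: state_after.simps)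
qed

text \<open>The \<open>c\<close> offers earn at least \<open>weight c\<close>, exactly the price of
  retiring one set of size \<open>c\<close>. They touch at most \<open>c * \<alpha>\<close> sets, so
  one survives, and its \<open>c\<close> elements are matched to the \<open>c\<close> new
  vertices.\<close>

lemma retire_set:
  assumes legal: "legal Ns" and clean: "clean Ns R" and sat: "saturating Ns R" and R: "R \<subseteq> {..<n}"
    and c: "0 < c" and many: "c * \<alpha> < card (active Ns R c)"
  shows "\<exists>Ns' R'. length Ns < length Ns' \<and> legal Ns' \<and> clean Ns' R' \<and> saturating Ns' R' \<and>
    R' \<subseteq> {..<n} \<and> potential Ns R \<le> potential Ns' R'"
proof -
  obtain X T where X: "length X = c" "legal (Ns @ X)" "clean (Ns @ X) R"
    "potential Ns R + real c * (weight c / real c) \<le> potential (Ns @ X) R"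
    "T \<subseteq> active Ns R c" "card (active Ns R c) \<le> card T + c * \<alpha>"
    "\<forall>u\<in>T. state (Ns @ X) u = state Ns u" "\<forall>N\<in>set X. \<forall>u\<in>T. state Ns u \<subseteq> N"
    using batch[OF legal clean order_refl c, of c] by blast
  have "card T \<noteq> 0" using X(6) many by linarith
  then obtain e where e: "e \<in> T" by (auto simp: card_eq_0_iff)
  let ?E = "state Ns e" and ?m = "state (Ns @ X)"
  have E: "e < length Ns" "?E \<inter> R = {}" "card ?E = c" "?m e = ?E"
    using e X(5,7) by (auto simp: active_def)
  note inv = state_invariants[OF X(2)]
  have finE: "finite ?E" by (rule finite_state[OF legal])
  have "saturating (Ns @ X) (R \<union> ?E)"
    using sat finE E(2,3) X(1,8) e by (intro saturating_append) auto
  moreover have "clean (Ns @ X) (R \<union> ?E)"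
    unfolding clean_def
  proof
    fix x
    show "?m x \<inter> (R \<union> ?E) = {} \<or> ?m x \<subseteq> R \<union> ?E"
    proof (cases "x = e")
      case False
      then have "?m x \<inter> ?E = {}" using inv(4)[of x e] E(4) by simp
      then show ?thesis using X(3) unfolding clean_def by blast
    qed (use E(4) in blast)
  qed
  moreover have "potential (Ns @ X) (R \<union> ?E) = potential (Ns @ X) R - weight c"
  proof -
    have "active_weight (Ns @ X) (R \<union> ?E) e = 0" "active_weight (Ns @ X) R e = weight c"
      using E c by (auto simp: active_weight_def)
    moreover have "active_weight (Ns @ X) (R \<union> ?E) u = active_weight (Ns @ X) R u" if "u \<noteq> e" for u
    proof -
      have "?m u \<inter> ?E = {}" using inv(4)[OF that] E(4) by simp
      then have "?m u \<inter> (R \<union> ?E) = {} \<longleftrightarrow> ?m u \<inter> R = {}" by blast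
      then show ?thesis unfolding active_weight_def by simp
    qed
    moreover have "e < length (Ns @ X)" using E(1) by simp
    ultimately have "(\<Sum>u<length (Ns @ X). active_weight (Ns @ X) (R \<union> ?E) u) =
        (\<Sum>u<length (Ns @ X). active_weight (Ns @ X) R u) - weight c"
      by (simp add: sum.remove[of "{..<length (Ns @ X)}" e] del: length_append)
    moreover have "unassigned (Ns @ X) (R \<union> ?E) = unassigned (Ns @ X) R"
      unfolding unassigned_def using E(4) by blast
    ultimately show ?thesis unfolding potential_def by simp
  qed
  moreover have "R \<union> ?E \<subseteq> {..<n}" using R state_invariants(1)[OF legal] by blast
  ultimately show ?thesis
    using X(1,2,4) c by (intro exI[of _ "Ns @ X"] exI[of _ "R \<union> ?E"]) auto
qed

text \<open>All unassigned elements are offered. Scheduler leaves at least one, \<open>d\<close>,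
  which is retired and matched to the new vertex.\<close>

lemma retire_unassigned:
  assumes legal: "legal Ns" and clean: "clean Ns R" and sat: "saturating Ns R" and R: "R \<subseteq> {..<n}"
    and many: "\<alpha> < card (unassigned Ns R)"
  shows "\<exists>Ns' R'. length Ns < length Ns' \<and> legal Ns' \<and> clean Ns' R' \<and> saturating Ns' R' \<and>
    R' \<subseteq> {..<n} \<and> potential Ns R \<le> potential Ns' R'"
proof -
  let ?L = "length Ns" and ?m = "state Ns"
  define N where "N = unassigned Ns R"
  define S where "S = A {..<n} Ns N"
  let ?m' = "state (Ns @ [N])"
  have N_D: "N \<subseteq> {..<n}" and NR: "N \<inter> R = {}" and Nm: "\<And>x. N \<inter> ?m x = {}"
    unfolding N_def unassigned_def by blast+
  have finN: "finite N" using N_D finite_subset by blast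
  have legal': "legal (Ns @ [N])" using legal N_D by (simp add: legal_snoc)
  have S: "S \<subseteq> N" "card S \<le> \<alpha>" using choice[OF legal'] by (auto simp: S_def)
  have "\<not> N \<subseteq> S"
    using many S card_mono[of S N] finN finite_subset[of S N] unfolding N_def[symmetric] by fastforce
  then obtain d where d: "d \<in> N" "d \<notin> S" by blast
  have m'L: "?m' ?L = S"
    unfolding state_snoc S_def by simp
  have m': "?m' x = ?m x" if "x \<noteq> ?L" for x
  proof -
    have "S \<inter> ?m x = {}" using S(1) Nm by blast
    then show ?thesis unfolding state_snoc S_def[symmetric] assign_other[OF that] by blast
  qed
  have mL: "?m ?L = {}" using state_invariants(3)[OF legal] by simp
  have dm: "d \<notin> ?m x" for x using d(1) Nm[of x] by blast
  have "saturating (Ns @ [N]) (R \<union> {d})"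
    using sat d NR by (intro saturating_append) auto
  moreover have "clean (Ns @ [N]) (R \<union> {d})"
    unfolding clean_def
  proof
    fix x
    show "?m' x \<inter> (R \<union> {d}) = {} \<or> ?m' x \<subseteq> R \<union> {d}"
    proof (cases "x = ?L")
      case True
      have "S \<inter> (R \<union> {d}) = {}" using S(1) NR d(2) by blast
      then show ?thesis unfolding True m'L by blast
    next
      case False
      have "?m x \<inter> R = {} \<or> ?m x \<subseteq> R" using clean unfolding clean_def by blast
      then show ?thesis unfolding m'[OF False] using dm[of x] by blast
    qed
  qed
  moreover have "R \<union> {d} \<subseteq> {..<n}" using R d(1) N_D by blast
  moreover have "potential Ns R \<le> potential (Ns @ [N]) (R \<union> {d})"
  proof -
    have "active_weight (Ns @ [N]) (R \<union> {d}) u = active_weight Ns R u" if "u < ?L" for u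
      using m'[of u] that dm[of u] unfolding active_weight_def by auto
    then have "(\<Sum>u<?L. active_weight (Ns @ [N]) (R \<union> {d}) u) = (\<Sum>u<?L. active_weight Ns R u)"
      by (intro sum.cong) auto
    moreover have "active_weight (Ns @ [N]) (R \<union> {d}) ?L = weight (card S)"
      unfolding active_weight_def m'L using S(1) NR d(2) by auto
    moreover have "real (card N) = real (card (unassigned (Ns @ [N]) (R \<union> {d}))) + real (card S) + 1"
    proof -
      have "(\<Union>x. ?m' x) = (\<Union>x. ?m x) \<union> S"
      proof (intro equalityI subsetI)
        fix y assume "y \<in> (\<Union>x. ?m' x)"
        then obtain x where "y \<in> ?m' x" by blast
        then have "y \<in> ?m x \<or> y \<in> S" using m'[of x] m'L by (cases "x = ?L") auto
        then show "y \<in> (\<Union>x. ?m x) \<union> S" by blast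
      next
        fix y assume "y \<in> (\<Union>x. ?m x) \<union> S"
        then consider x where "y \<in> ?m x" | "y \<in> S" by blast
        then show "y \<in> (\<Union>x. ?m' x)"
        proof cases
          case (1 x)
          then have "x \<noteq> ?L" using mL by auto
          with 1 m'[of x] have "y \<in> ?m' x" by simp
          then show ?thesis by blast
        next
          case 2
          then have "y \<in> ?m' ?L" using m'L by simp
          then show ?thesis by blast
        qed
      qed
      then have "unassigned (Ns @ [N]) (R \<union> {d}) = N - insert d S"
        unfolding unassigned_def N_def by blast
      moreover have "card (N - insert d S) = card N - card (insert d S)"
        using S(1) d(1) finN by (intro card_Diff_subset) (auto intro: finite_subset)
      moreover have "card (insert d S) \<le> card N"
        using S(1) d(1) finN by (intro card_mono) auto
      moreover have "card (insert d S) = Suc (card S)"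
        using S(1) d(2) finN by (meson card_insert_disjoint finite_subset)
      ultimately show ?thesis by simp
    qed
    \<comment> \<open>The round uses up \<open>card S + 1\<close> unassigned elements. Since
      \<open>fail_ratio\<close> is antitone, the new set pays for them even if Scheduler takes fewer
      than \<alpha>.\<close>
    moreover have "fail_ratio \<alpha> * (real (card S) + 1) \<le> weight (card S)"
    proof -
      have "fail_ratio \<alpha> \<le> fail_ratio (card S)" by (rule fail_ratio_antimono[OF S(2)])
      then have "fail_ratio \<alpha> * (real (card S) + 1) \<le> fail_ratio (card S) * (real (card S) + 1)"
        by (intro mult_right_mono) auto
      then show ?thesis by (simp add: fail_ratio_def add.commute)
    qed
    ultimately show ?thesis
      unfolding potential_def N_def[symmetric] by (simp add: algebra_simps)
  qed
  ultimately show ?thesis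
    using legal' by (intro exI[of _ "Ns @ [N]"] exI[of _ "R \<union> {d}"]) auto
qed

text \<open>Each retirement adds rounds, and there are as many rounds as retired elements, hence at
  most \<open>n\<close>. So Builder gets stuck, with the initial worth preserved.\<close>

lemma stuck_position:
  "\<exists>Ns R. legal Ns \<and> saturating Ns R \<and> R \<subseteq> {..<n} \<and> fail_ratio \<alpha> * real n \<le> potential Ns R \<and>
    card (unassigned Ns R) \<le> \<alpha> \<and> (\<forall>c>0. card (active Ns R c) \<le> c * \<alpha>)"
proof -
  define good where "good Ns R \<longleftrightarrow> legal Ns \<and> clean Ns R \<and> saturating Ns R \<and> R \<subseteq> {..<n} \<and>
    fail_ratio \<alpha> * real n \<le> potential Ns R" for Ns R
  have length_le: "length Ns \<le> n" if "good Ns R" for Ns R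
    using that saturating_card[of Ns R] card_mono[of "{..<n}" R] by (auto simp: good_def)
  have "good [] {}"
    by (simp add: good_def is_game_def clean_def saturating_Nil potential_def unassigned_def)
  moreover have "\<exists>Ns' R'. good Ns' R' \<and> card (unassigned Ns' R') \<le> \<alpha> \<and> (\<forall>c>0. card (active Ns' R' c) \<le> c * \<alpha>)"
    if "good Ns R" for Ns R
    using that
  proof (induction "n - length Ns" arbitrary: Ns R rule: less_induct)
    case less
    show ?case
    proof (cases "card (unassigned Ns R) \<le> \<alpha> \<and> (\<forall>c>0. card (active Ns R c) \<le> c * \<alpha>)")
      case True
      with less.prems show ?thesis by blast
    next
      case False
      have g: "legal Ns" "clean Ns R" "saturating Ns R" "R \<subseteq> {..<n}"
        using less.prems by (auto simp: good_def)
      have "\<exists>Ns' R'. length Ns < length Ns' \<and> legal Ns' \<and> clean Ns' R' \<and> saturating Ns' R' \<and>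
          R' \<subseteq> {..<n} \<and> potential Ns R \<le> potential Ns' R'"
        using False retire_set[OF g] retire_unassigned[OF g] by (meson not_le)
      then obtain Ns' R' where "length Ns < length Ns'" "good Ns' R'"
        using less.prems unfolding good_def by (meson order_trans)
      moreover from this have "n - length Ns' < n - length Ns" using length_le[of Ns' R'] by linarith
      ultimately show ?thesis using less.hyps by blast
    qed
  qed
  ultimately show ?thesis unfolding good_def by blast
qed

definition failures :: "nat set list \<Rightarrow> nat set" where
  "failures Ns = {u. u < length Ns \<and> state Ns u = {}}"

lemma failures_snoc: "card (failures Ns) \<le> card (failures (Ns @ [N]))"
proof (rule card_mono)
  show "finite (failures (Ns @ [N]))" by (simp add: failures_def)
  show "failures Ns \<subseteq> failures (Ns @ [N])"
    unfolding failures_def state_snoc by (auto simp: assign_other)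
qed

text \<open>Offering a single unretired element extends the perfect matching by one edge, and an
  empty earlier set can never be refilled.\<close>

lemma pad:
  assumes "legal Ns" "saturating Ns R" "R \<subseteq> {..<n}"
  shows "\<exists>Ns' R'. length Ns' = n \<and> legal Ns' \<and> saturating Ns' R' \<and> card (failures Ns) \<le> card (failures Ns')"
  using assms
proof (induction "n - length Ns" arbitrary: Ns R)
  case 0
  have "length Ns \<le> n" using saturating_card[OF 0(3)] card_mono[OF _ 0(4)] by simp
  with 0 show ?case by (intro exI[of _ Ns] exI[of _ R]) auto
next
  case (Suc k)
  have "card R < n" using Suc(2) saturating_card[OF Suc(4)] by simp
  then have "R \<noteq> {..<n}" by auto
  then obtain d where d: "d < n" "d \<notin> R" using Suc(5) by auto
  have "saturating (Ns @ [{d}]) (R \<union> {d})"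
    using Suc(4) d by (intro saturating_append) auto
  moreover have "legal (Ns @ [{d}])" using Suc(3) d by (simp add: legal_snoc)
  moreover have "k = n - length (Ns @ [{d}])" using Suc(2) by simp
  moreover have "R \<union> {d} \<subseteq> {..<n}" using Suc(5) d by simp
  ultimately obtain Ns' R' where "length Ns' = n" "legal Ns'" "saturating Ns' R'"
    "card (failures (Ns @ [{d}])) \<le> card (failures Ns')"
    using Suc(1) by blast
  with failures_snoc[of Ns "{d}"] show ?case
    by (intro exI[of _ Ns'] exI[of _ R']) auto
qed

text \<open>Active worth sits in empty sets, counted as failures, or in sets of sizes 1 to \<alpha>,
  few of each size.\<close>

lemma potential_le_failures:
  assumes "legal Ns" "card (unassigned Ns R) \<le> \<alpha>" "\<forall>c>0. card (active Ns R c) \<le> c * \<alpha>"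
  shows "potential Ns R \<le> real (card (failures Ns)) +
    ((\<Sum>c=1..\<alpha>. real (c * \<alpha>) * weight c) + fail_ratio \<alpha> * real \<alpha>)"
proof -
  have "active_weight Ns R u \<le> (if u \<in> failures Ns then 1 else 0) +
      (\<Sum>c=1..\<alpha>. if u \<in> active Ns R c then weight c else 0)" if "u < length Ns" for u
  proof -
    have nonneg: "0 \<le> (\<Sum>c=1..\<alpha>. if u \<in> active Ns R c then weight c else 0)"
      using weight_pos by (intro sum_nonneg) (auto intro: less_imp_le)
    consider "state Ns u \<inter> R \<noteq> {}" | "state Ns u = {}" | "state Ns u \<inter> R = {}" "state Ns u \<noteq> {}"
      by blast
    then show ?thesis
    proof cases
      case 3
      let ?c = "card (state Ns u)"
      have "?c \<in> {1..\<alpha>}"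
        using 3 finite_state[OF assms(1)] state_invariants(2)[OF assms(1)] by (auto simp: Suc_le_eq card_gt_0_iff)
      then have "(if u \<in> active Ns R ?c then weight ?c else 0) \<le>
          (\<Sum>c=1..\<alpha>. if u \<in> active Ns R c then weight c else 0)"
        using weight_pos by (intro member_le_sum) (auto intro: less_imp_le)
      moreover have "u \<in> active Ns R ?c" using 3 that by (simp add: active_def)
      ultimately show ?thesis using 3 by (simp add: active_weight_def failures_def)
    qed (use nonneg that in \<open>auto simp: active_weight_def failures_def\<close>)
  qed
  then have "(\<Sum>u<length Ns. active_weight Ns R u) \<le>
      (\<Sum>u<length Ns. (if u \<in> failures Ns then 1 else 0) +
        (\<Sum>c=1..\<alpha>. if u \<in> active Ns R c then weight c else 0))"
    by (intro sum_mono) auto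
  also have "\<dots> = (\<Sum>u<length Ns. if u \<in> failures Ns then 1 else 0) +
      (\<Sum>c=1..\<alpha>. \<Sum>u<length Ns. if u \<in> active Ns R c then weight c else 0)"
    by (subst sum.swap) (simp add: sum.distrib)
  also have "(\<Sum>u<length Ns. if u \<in> failures Ns then 1 else 0) = real (card (failures Ns))"
  proof -
    have "{..<length Ns} \<inter> failures Ns = failures Ns" by (auto simp: failures_def)
    then show ?thesis by (simp add: sum.If_cases)
  qed
  also have "(\<Sum>c=1..\<alpha>. \<Sum>u<length Ns. if u \<in> active Ns R c then weight c else 0) =
      (\<Sum>c=1..\<alpha>. real (card (active Ns R c)) * weight c)"
  proof (rule sum.cong)
    fix c
    have "{..<length Ns} \<inter> active Ns R c = active Ns R c" by (auto simp: active_def)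
    then show "(\<Sum>u<length Ns. if u \<in> active Ns R c then weight c else 0) =
        real (card (active Ns R c)) * weight c"
      by (simp add: sum.If_cases)
  qed simp
  also have "\<dots> \<le> (\<Sum>c=1..\<alpha>. real (c * \<alpha>) * weight c)"
    using assms(3) weight_pos
    by (intro sum_mono mult_right_mono) (auto intro: less_imp_le simp del: of_nat_mult)
  finally have "(\<Sum>u<length Ns. active_weight Ns R u) \<le>
      real (card (failures Ns)) + (\<Sum>c=1..\<alpha>. real (c * \<alpha>) * weight c)" by simp
  moreover have "fail_ratio \<alpha> * real (card (unassigned Ns R)) \<le> fail_ratio \<alpha> * real \<alpha>"
    using assms(2) fail_ratio_pos[of \<alpha>] by (intro mult_left_mono) auto
  ultimately show ?thesis unfolding potential_def by linarith
qed

lemma hard_game: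
  "\<exists>Ns. is_game {..<n} Ns \<and> game_size Ns = n \<and>
    real (constructed_size A {..<n} Ns) \<le> (1 - fail_ratio \<alpha>) * real n +
      ((\<Sum>c=1..\<alpha>. real (c * \<alpha>) * weight c) + fail_ratio \<alpha> * real \<alpha>)"
proof -
  obtain Ns R where Ns: "legal Ns" "saturating Ns R" "R \<subseteq> {..<n}" "fail_ratio \<alpha> * real n \<le> potential Ns R"
    "card (unassigned Ns R) \<le> \<alpha>" "\<forall>c>0. card (active Ns R c) \<le> c * \<alpha>"
    using stuck_position by blast
  obtain Ns' R' where Ns': "length Ns' = n" "legal Ns'" "saturating Ns' R'"
    "card (failures Ns) \<le> card (failures Ns')"
    using pad[OF Ns(1-3)] by blast
  have "real (constructed_size A {..<n} Ns') = real n - real (card (failures Ns'))"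
    using constructed_size_failures[of A "{..<n}" Ns'] Ns'(1) unfolding failures_def by linarith
  moreover have "fail_ratio \<alpha> * real n \<le> real (card (failures Ns')) +
      ((\<Sum>c=1..\<alpha>. real (c * \<alpha>) * weight c) + fail_ratio \<alpha> * real \<alpha>)"
    using potential_le_failures[OF Ns(1,5,6)] Ns(4) Ns'(4) by linarith
  ultimately show ?thesis
    using Ns'(1,2) game_size_saturating[OF Ns'(3)] by (intro exI[of _ Ns']) (auto simp: left_diff_distrib)
qed

end

section \<open>The competitive ratio\<close>

text \<open>\<open>is_balanced\<close> speaks only about rounds of a game, so the pending offer
  \<open>N\<close> is viewed as the last round of \<open>Ns @ [N]\<close>.\<close>

lemma is_balanced_imp_lazy:
  assumes "is_balanced \<alpha> A"
  shows "lazy_scheduler \<alpha> A"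
  unfolding lazy_scheduler_def
proof (intro allI impI)
  fix D Ns N
  assume game: "is_game D (Ns @ [N])"
  interpret balanced_game \<alpha> A D "Ns @ [N]"
    by unfold_locales (fact assms game)+
  have k: "length Ns < length (Ns @ [N])" by simp
  have "st (Suc (length Ns)) (length Ns) = A D Ns N" by simp
  then show "A D Ns N \<subseteq> N \<and> card (A D Ns N) \<le> \<alpha>"
    using round_start.round_subset[OF round_start_round[OF k] balanced_round[OF k]]
      round_start.round_card[OF round_start_round[OF k] balanced_round[OF k]]
    by (simp del: state_after.simps)
qed

text \<open>\<open>hard_game\<close> provides a game of every size, so the minimum is taken over a
  nonempty set; \<open>constructed_size_le_game_size\<close> makes that set finite.\<close>

lemma
  assumes "lazy_scheduler \<alpha> A"
  shows scheduler_val_attained: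
      "\<exists>D Ns. is_game D Ns \<and> game_size Ns = n \<and> scheduler_val A n = constructed_size A D Ns"
    and scheduler_val_le:
      "is_game D Ns \<Longrightarrow> game_size Ns = n \<Longrightarrow> scheduler_val A n \<le> constructed_size A D Ns"
    and scheduler_val_le_size: "scheduler_val A n \<le> n"
proof -
  interpret adversary \<alpha> n A by unfold_locales fact
  let ?V = "{constructed_size A D Ns | D Ns. is_game D Ns \<and> game_size Ns = n}"
  have sub: "?V \<subseteq> {..n}" using constructed_size_le_game_size[OF assms] by auto
  then have fin: "finite ?V" using finite_subset by blast
  have ne: "?V \<noteq> {}" using hard_game by blast
  have mem: "scheduler_val A n \<in> ?V" unfolding scheduler_val_def by (rule Min_in[OF fin ne])
  then show "\<exists>D Ns. is_game D Ns \<and> game_size Ns = n \<and> scheduler_val A n = constructed_size A D Ns"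
    by blast
  show "scheduler_val A n \<le> n" using mem sub by blast
  show "scheduler_val A n \<le> constructed_size A D Ns" if "is_game D Ns" "game_size Ns = n"
    unfolding scheduler_val_def using that by (intro Min_le[OF fin]) blast
qed

lemma scheduler_val_balanced_ge:
  assumes "is_balanced \<alpha> A"
  shows "(1 - fail_ratio \<alpha>) * real n \<le> real (scheduler_val A n)"
proof -
  obtain D Ns where *: "is_game D Ns" "game_size Ns = n" "scheduler_val A n = constructed_size A D Ns"
    using scheduler_val_attained[OF is_balanced_imp_lazy[OF assms]] by blast
  interpret balanced_game \<alpha> A D Ns by unfold_locales (fact assms *)+
  obtain M where "is_matching (game_edges Ns) M" "card M = n"
    using maximum_matching *(2) by metis
  then show ?thesis using constructed_size_ge *(3) by metis
qed

definition adversary_loss :: "nat \<Rightarrow> real" where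
  "adversary_loss \<alpha> = (\<Sum>c=1..\<alpha>. real (c * \<alpha>) * weight c) + fail_ratio \<alpha> * real \<alpha>"

lemma scheduler_val_le_linear:
  assumes "lazy_scheduler \<alpha> A"
  shows "real (scheduler_val A n) \<le> (1 - fail_ratio \<alpha>) * real n + adversary_loss \<alpha>"
proof -
  interpret adversary \<alpha> n A by unfold_locales fact
  obtain Ns where Ns: "is_game {..<n} Ns" "game_size Ns = n"
    "real (constructed_size A {..<n} Ns) \<le> (1 - fail_ratio \<alpha>) * real n + adversary_loss \<alpha>"
    using hard_game unfolding adversary_loss_def by blast
  have "real (scheduler_val A n) \<le> real (constructed_size A {..<n} Ns)"
    using scheduler_val_le[OF assms Ns(1,2)] by simp
  then show ?thesis using Ns(3) by linarith
qed

lemma lazy_val_bounds: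
  "(1 - fail_ratio \<alpha>) * real n \<le> real (lazy_val \<alpha> n)"
  "real (lazy_val \<alpha> n) \<le> (1 - fail_ratio \<alpha>) * real n + adversary_loss \<alpha>"
proof -
  let ?V = "{scheduler_val A n | A. lazy_scheduler \<alpha> A}"
  let ?B = "balanced_scheduler \<alpha>"
  have fin: "finite ?V"
    by (rule finite_subset[of _ "{..n}"]) (auto dest: scheduler_val_le_size)
  have B: "is_balanced \<alpha> ?B" by (rule is_balanced_balanced_scheduler)
  then have mem: "scheduler_val ?B n \<in> ?V" using is_balanced_imp_lazy by blast
  then have "lazy_val \<alpha> n \<in> ?V" unfolding lazy_val_def by (intro Max_in[OF fin]) blast
  then show "real (lazy_val \<alpha> n) \<le> (1 - fail_ratio \<alpha>) * real n + adversary_loss \<alpha>"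
    using scheduler_val_le_linear by auto
  have "scheduler_val ?B n \<le> lazy_val \<alpha> n" unfolding lazy_val_def by (rule Max_ge[OF fin mem])
  then show "(1 - fail_ratio \<alpha>) * real n \<le> real (lazy_val \<alpha> n)"
    using scheduler_val_balanced_ge[OF B, of n] by linarith
qed

text \<open>An additive constant vanishes after division by \<open>n\<close>, so the quotient even
  converges.\<close>

lemma competitive_ratio_eqI:
  assumes "\<And>n. r * real n \<le> real (val n)" "\<And>n. real (val n) \<le> r * real n + C"
  shows "competitive_ratio val = ereal r"
proof -
  have "(\<lambda>n. real (val n) / real n) \<longlonglongrightarrow> r"
  proof (rule tendsto_sandwich)
    show "\<forall>\<^sub>F n in sequentially. r \<le> real (val n) / real n"
      using eventually_gt_at_top[of 0] by eventually_elim (use assms(1) in \<open>simp add: le_divide_eq\<close>)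
    show "\<forall>\<^sub>F n in sequentially. real (val n) / real n \<le> r + C * (1 / real n)"
      using eventually_gt_at_top[of 0]
      by eventually_elim (use assms(2) in \<open>simp add: divide_le_eq distrib_right\<close>)
    have "(\<lambda>n. r + C * (1 / real n)) \<longlonglongrightarrow> r + C * 0"
      by (intro tendsto_intros lim_1_over_n)
    then show "(\<lambda>n. r + C * (1 / real n)) \<longlonglongrightarrow> r" by simp
  qed simp
  then have "(\<lambda>n. ereal (real (val n) / real n)) \<longlonglongrightarrow> ereal r" by simp
  then show ?thesis unfolding competitive_ratio_def by (intro lim_imp_Liminf) simp_all
qed

section \<open>The limit of the ratios\<close>

text \<open>The polynomial \<open>1 + x + x^2\<close> factors as
  \<open>(a + x) * (1 - a + x)\<close>, so the numerators form a product of two Pochhammer symbols.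
  The limit formula for \<open>rGamma\<close> and Euler's reflection formula evaluate it.\<close>

lemma tendsto_prod_quadratic:
  "(\<lambda>n. \<Prod>i=1..n. (1 + real i + (real i)\<^sup>2) / (real i + (real i)\<^sup>2)) \<longlonglongrightarrow> cosh (sqrt 3 / 2 * pi) / pi"
proof -
  define a where "a = Complex (1/2) (sqrt 3 / 2)"
  define Q where "Q n = (\<Prod>i=1..n. (1 + real i + (real i)\<^sup>2) / (real i + (real i)\<^sup>2))" for n
  have a: "a * (1 - a) = 1"
    by (simp add: a_def complex_eq_iff field_simps)
  \<comment> \<open>The denominators multiply to \<open>fact n * fact n * (1 + n)\<close>, whereas
    the two series supply \<open>fact n * fact n * n\<close>; hence the extra factor, which tends to
    1.\<close>
  have series: "rGamma_series a n * rGamma_series (1 - a) n = of_real (Q n * (1 + 1 / real n))"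
    if "0 < n" for n
  proof -
    have "pochhammer a (n + 1) * pochhammer (1 - a) (n + 1) =
        (\<Prod>i=0..n. (a + of_nat i) * (1 - a + of_nat i))"
      by (simp add: pochhammer_Suc_prod prod.distrib)
    also have "\<dots> = (\<Prod>i=0..n. of_real (1 + real i + (real i)\<^sup>2))"
    proof (rule prod.cong)
      fix i
      have "(a + of_nat i) * (1 - a + of_nat i) = a * (1 - a) + of_nat i + (of_nat i)\<^sup>2"
        by (simp add: algebra_simps power2_eq_square)
      then show "(a + of_nat i) * (1 - a + of_nat i) = of_real (1 + real i + (real i)\<^sup>2)"
        by (simp add: a)
    qed simp
    \<comment> \<open>The factor for \<open>i = 0\<close> is \<open>a * (1 - a) = 1\<close>.\<close>
    also have "\<dots> = of_real (\<Prod>i=1..n. 1 + real i + (real i)\<^sup>2)"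
      by (simp add: prod.atLeast_Suc_atMost)
    finally have num: "pochhammer a (n + 1) * pochhammer (1 - a) (n + 1) =
      of_real (\<Prod>i=1..n. 1 + real i + (real i)\<^sup>2)" .
    have "exp (a * of_real (ln (real n))) * exp ((1 - a) * of_real (ln (real n))) = exp (of_real (ln (real n)))"
      by (simp add: exp_add[symmetric] algebra_simps)
    also have "\<dots> = of_real (real n)" using that by (simp add: exp_of_real)
    finally have ex: "exp (a * of_real (ln (real n))) * exp ((1 - a) * of_real (ln (real n))) = of_real (real n)" .
    have "(\<Prod>i=1..n. real i + (real i)\<^sup>2) = fact n * fact n * (1 + real n)"
      by (induction n) (simp_all add: algebra_simps power2_eq_square)
    then have Q: "(\<Prod>i=1..n. 1 + real i + (real i)\<^sup>2) = Q n * (fact n * fact n * (1 + real n))"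
      unfolding Q_def prod_dividef by simp
    have "rGamma_series a n * rGamma_series (1 - a) n =
        (pochhammer a (n + 1) * pochhammer (1 - a) (n + 1)) /
        (fact n * fact n * (exp (a * of_real (ln (real n))) * exp ((1 - a) * of_real (ln (real n)))))"
      by (simp add: rGamma_series_def mult_ac)
    also have "\<dots> = of_real (Q n * (fact n * fact n * (1 + real n))) / (fact n * fact n * of_real (real n))"
      unfolding num ex Q ..
    also have "\<dots> = of_real (Q n * (fact n * fact n * (1 + real n)) / (fact n * fact n * real n))"
      by simp
    also have "Q n * (fact n * fact n * (1 + real n)) / (fact n * fact n * real n) = Q n * (1 + 1 / real n)"
      using that by (simp add: field_simps)
    finally show ?thesis .
  qed
  have "(\<lambda>n. rGamma_series a n * rGamma_series (1 - a) n) \<longlonglongrightarrow> rGamma a * rGamma (1 - a)"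
    by (intro tendsto_mult rGamma_series_LIMSEQ)
  also have "rGamma a * rGamma (1 - a) = sin (of_real pi * a) / of_real pi"
    by (rule rGamma_reflection_complex)
  \<comment> \<open>The real part 1/2 of \<open>a\<close> shifts the sine by a quarter period,
    leaving the cosine of an imaginary number, that is, \<open>cosh\<close>.\<close>
  also have "of_real pi * a = of_real pi / 2 + \<i> * of_real (sqrt 3 / 2 * pi)"
    by (simp add: a_def complex_eq_iff)
  also have "sin (of_real pi / 2 + \<i> * of_real (sqrt 3 / 2 * pi)) = cosh (of_real (sqrt 3 / 2 * pi) :: complex)"
    by (simp only: sin_add sin_of_real_pi_half cos_of_real_pi_half cosh_conv_cos) simp
  also have "\<dots> = of_real (cosh (sqrt 3 / 2 * pi))" by (simp add: cosh_field_def exp_of_real[symmetric])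
  finally have "(\<lambda>n. rGamma_series a n * rGamma_series (1 - a) n) \<longlonglongrightarrow>
      of_real (cosh (sqrt 3 / 2 * pi) / pi)" by simp
  then have "(\<lambda>n. of_real (Q n * (1 + 1 / real n)) :: complex) \<longlonglongrightarrow> of_real (cosh (sqrt 3 / 2 * pi) / pi)"
    by (rule Lim_transform_eventually) (use series in \<open>auto intro: eventually_sequentiallyI[of 1]\<close>)
  then have "(\<lambda>n. Q n * (1 + 1 / real n)) \<longlonglongrightarrow> cosh (sqrt 3 / 2 * pi) / pi"
    by (simp only: tendsto_of_real_iff)
  moreover have "(\<lambda>n. 1 + 1 / real n) \<longlonglongrightarrow> 1 + 0"
    by (intro tendsto_intros lim_1_over_n)
  ultimately have "(\<lambda>n. Q n * (1 + 1 / real n) / (1 + 1 / real n)) \<longlonglongrightarrow> cosh (sqrt 3 / 2 * pi) / pi / (1 + 0)"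
    by (intro tendsto_divide) auto
  moreover have "Q n * (1 + 1 / real n) / (1 + 1 / real n) = Q n" for n
  proof -
    have "0 < 1 + 1 / real n" by (simp add: add_pos_nonneg)
    then show ?thesis by simp
  qed
  ultimately show ?thesis unfolding Q_def by simp
qed

lemma tendsto_ratio_formula:
  "(\<lambda>\<alpha>. 1 - real \<alpha> / (1 + real \<alpha>) * (\<Prod>i=1..\<alpha> - 1. (real i + (real i)\<^sup>2) / (1 + real i + (real i)\<^sup>2)))
     \<longlonglongrightarrow> 1 - pi / cosh (sqrt 3 / 2 * pi)"
proof -
  let ?P = "\<lambda>n. \<Prod>i=1..n. (real i + (real i)\<^sup>2) / (1 + real i + (real i)\<^sup>2)"
  have "?P n = 1 / (\<Prod>i=1..n. (1 + real i + (real i)\<^sup>2) / (real i + (real i)\<^sup>2))" for n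
    by (simp add: prod_dividef)
  moreover have "(\<lambda>n. 1 / (\<Prod>i=1..n. (1 + real i + (real i)\<^sup>2) / (real i + (real i)\<^sup>2)))
      \<longlonglongrightarrow> 1 / (cosh (sqrt 3 / 2 * pi) / pi)"
    by (intro tendsto_intros tendsto_prod_quadratic) simp
  ultimately have "?P \<longlonglongrightarrow> pi / cosh (sqrt 3 / 2 * pi)" by simp
  moreover have "(\<lambda>n. 1 / (2 + real n)) \<longlonglongrightarrow> 0"
    using LIMSEQ_Suc[OF LIMSEQ_inverse_real_of_nat] by (simp add: inverse_eq_divide algebra_simps)
  ultimately have "(\<lambda>n. 1 - (1 - 1 / (2 + real n)) * ?P n) \<longlonglongrightarrow> 1 - (1 - 0) * (pi / cosh (sqrt 3 / 2 * pi))"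
    by (intro tendsto_intros)
  moreover have "1 - 1 / (2 + real n) = real (Suc n) / (1 + real (Suc n))" for n
    by (simp add: field_simps)
  \<comment> \<open>Working at \<open>Suc n\<close> avoids the truncated subtraction in
    \<open>\<alpha> - 1\<close> at 0.\<close>
  ultimately have "(\<lambda>n. 1 - real (Suc n) / (1 + real (Suc n)) * ?P (Suc n - 1)) \<longlonglongrightarrow> 1 - pi / cosh (sqrt 3 / 2 * pi)"
    by simp
  then show ?thesis by (rule LIMSEQ_imp_Suc)
qed

text \<open>Taylor estimates for the sine on both sides of \<open>pi / 6\<close>, where it equals
  1/2; the bound 53/100 exceeds both evaluation points.\<close>

lemma pi_bounds: "3.1415 < pi" "pi < 3.1417"
proof -
  have sin_approx: "sin x \<le> x - x ^ 3 / 6 + x ^ 5 / 120 + 1 / 200000"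
      "x - x ^ 3 / 6 + x ^ 5 / 120 - 1 / 200000 \<le> sin x" if "0 \<le> x" "x \<le> 53/100" for x :: real
  proof -
    have "\<bar>sin x - (\<Sum>m<7. sin_coeff m * x ^ m)\<bar> \<le> inverse (fact 7) * \<bar>x\<bar> ^ 7"
      by (rule Maclaurin_sin_bound)
    also have "{..<7} = {0, 1, 2, 3, 4, 5, 6 :: nat}" by auto
    then have "(\<Sum>m<7. sin_coeff m * x ^ m) = x - x ^ 3 / 6 + x ^ 5 / 120"
      by (simp add: sin_coeff_def fact_numeral)
    also have "inverse (fact 7) * \<bar>x\<bar> ^ 7 \<le> inverse (fact 7) * (53/100) ^ 7"
      using that by (intro mult_left_mono power_mono) auto
    also have "inverse (fact 7) * (53/100 :: real) ^ 7 \<le> 1 / 200000"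
      by (simp add: fact_numeral power_divide)
    finally have "\<bar>sin x - (x - x ^ 3 / 6 + x ^ 5 / 120)\<bar> \<le> 1 / 200000" .
    then show "sin x \<le> x - x ^ 3 / 6 + x ^ 5 / 120 + 1 / 200000"
      "x - x ^ 3 / 6 + x ^ 5 / 120 - 1 / 200000 \<le> sin x" by linarith+
  qed
  have "sin (3.1415 / 6 :: real) < 1 / 2" "1 / 2 < sin (3.1417 / 6 :: real)"
    using sin_approx(1)[of "3.1415 / 6"] sin_approx(2)[of "3.1417 / 6"] by (simp_all add: power_divide)
  moreover have "sin (pi / 6) = 1 / 2" by (rule sin_30)
  moreover have "3.1415 / 6 < pi / 6 \<longleftrightarrow> sin (3.1415 / 6) < sin (pi / 6)"
    using pi_ge_two by (intro sin_mono_less_eq[symmetric]) auto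
  moreover have "pi / 6 < 3.1417 / 6 \<longleftrightarrow> sin (pi / 6) < sin (3.1417 / 6)"
    using pi_ge_two by (intro sin_mono_less_eq[symmetric]) auto
  ultimately have "3.1415 / 6 < pi / 6" "pi / 6 < 3.1417 / 6" by (simp_all only:)
  then show "3.1415 < pi" "pi < 3.1417" by simp_all
qed

text \<open>The interval encloses \<open>sqrt 3 / 2 * pi\<close>, which is about 2.7207.\<close>

lemma exp_bounds:
  fixes x :: real
  assumes "2.7206 \<le> x" "x \<le> 2.7209"
  shows "15.18 \<le> exp x" "exp x \<le> 15.2"
proof -
  let ?s = "\<lambda>x::real. \<Sum>m<14. x ^ m / fact m"
  have set: "{..<14} = {0, 1, 2, 3, 4, 5, 6, 7, 8, 9, 10, 11, 12, 13 :: nat}" by (auto simp: less_Suc_eq eval_nat_numeral)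
  obtain t where "exp 2.7206 = ?s 2.7206 + exp t / fact 14 * 2.7206 ^ 14"
    using Maclaurin_exp_le[of "2.7206" 14] by blast
  then have "?s 2.7206 \<le> exp 2.7206" by simp
  also have "\<dots> \<le> exp x" using assms(1) by simp
  finally show "15.18 \<le> exp x" unfolding set by (simp add: fact_numeral power_divide)
  obtain t where t: "\<bar>t\<bar> \<le> \<bar>2.7209 :: real\<bar>" "exp 2.7209 = ?s 2.7209 + exp t / fact 14 * 2.7209 ^ 14"
    using Maclaurin_exp_le[of "2.7209" 14] by blast
  \<comment> \<open>The Taylor remainder involves the exponential itself. It is a tiny multiple of
    \<open>exp 2.7209\<close> and is absorbed into the left-hand side.\<close>
  have "exp t \<le> exp 2.7209" using t(1) by simp
  then have "exp t * (2.7209 ^ 14 / fact 14) \<le> exp 2.7209 * (2.7209 ^ 14 / fact 14)"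
    by (rule mult_right_mono) simp
  then have "exp 2.7209 \<le> ?s 2.7209 + exp 2.7209 * (2.7209 ^ 14 / fact 14)"
    using t(2) by simp
  also have "(2.7209 :: real) ^ 14 / fact 14 \<le> 1 / 50000" by (simp add: fact_numeral power_divide)
  finally have "exp 2.7209 * (1 - 1 / 50000) \<le> ?s 2.7209" by (simp add: algebra_simps)
  moreover have "?s 2.7209 \<le> 15.199" unfolding set by (simp add: fact_numeral power_divide)
  ultimately have "exp 2.7209 \<le> (15.2 :: real)" by simp
  moreover have "exp x \<le> exp 2.7209" using assms(2) by simp
  ultimately show "exp x \<le> 15.2" by (rule order_trans[rotated])
qed

lemma ratio_limit_approx: "\<bar>1 - pi / cosh (sqrt 3 / 2 * pi) - 0.588\<bar> < 0.0005"
proof -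
  let ?x = "sqrt 3 / 2 * pi"
  have "1.73205 < sqrt 3" "sqrt 3 < 1.73206"
    by (rule real_less_rsqrt, simp add: power2_eq_square) (rule real_less_lsqrt, simp_all add: power2_eq_square)
  then have "1.73205 / 2 * 3.1415 \<le> ?x" "?x \<le> 1.73206 / 2 * 3.1417"
    using pi_bounds by (intro mult_mono; simp)+
  then have e: "15.18 \<le> exp ?x" "exp ?x \<le> 15.2" using exp_bounds[of ?x] by auto
  have "inverse (15.2) \<le> inverse (exp ?x)" "inverse (exp ?x) \<le> inverse (15.18)"
    using e by (intro le_imp_inverse_le; simp)+
  then have c: "7.622 \<le> cosh ?x" "cosh ?x \<le> 7.633"
    using e by (simp_all add: cosh_field_def exp_minus)
  have "pi / cosh ?x < 0.4125"
    using pi_bounds c by (simp add: divide_less_eq)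
  moreover have "0.4115 < pi / cosh ?x"
    using pi_bounds c by (simp add: less_divide_eq)
  moreover have "\<bar>1 - q - 0.588\<bar> < 0.0005" if "q < 0.4125" "0.4115 < q" for q :: real
    using that by (simp add: abs_if)
  ultimately show ?thesis by blast
qed

theorem theorem2:
  "(\<forall>\<alpha>\<ge>1.
      competitive_ratio (lazy_val \<alpha>) =
        ereal (1 - real \<alpha> / (1 + real \<alpha>) *
          (\<Prod>i=1..\<alpha> - 1. (real i + (real i)\<^sup>2) / (1 + real i + (real i)\<^sup>2))) \<and>
      (\<exists>A. is_balanced \<alpha> A) \<and>
      (\<forall>A. is_balanced \<alpha> A \<longrightarrow>
        lazy_scheduler \<alpha> A \<and>
        competitive_ratio (scheduler_val A) = competitive_ratio (lazy_val \<alpha>))) \<and>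
   (\<lambda>\<alpha>. 1 - real \<alpha> / (1 + real \<alpha>) *
      (\<Prod>i=1..\<alpha> - 1. (real i + (real i)\<^sup>2) / (1 + real i + (real i)\<^sup>2)))
     \<longlonglongrightarrow> 1 - pi / cosh (sqrt 3 / 2 * pi) \<and>
   \<bar>1 - pi / cosh (sqrt 3 / 2 * pi) - 0.588\<bar> < 0.0005"
proof -
  let ?r = "\<lambda>\<alpha>. 1 - real \<alpha> / (1 + real \<alpha>) *
      (\<Prod>i=1..\<alpha> - 1. (real i + (real i)\<^sup>2) / (1 + real i + (real i)\<^sup>2))"
  have "competitive_ratio (lazy_val \<alpha>) = ereal (?r \<alpha>)" if "\<alpha> \<ge> 1" for \<alpha>
    using competitive_ratio_eqI[OF lazy_val_bounds] fail_ratio_eq[OF that] by simp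
  moreover have "competitive_ratio (scheduler_val A) = ereal (?r \<alpha>)"
    if "\<alpha> \<ge> 1" "is_balanced \<alpha> A" for \<alpha> A
    using competitive_ratio_eqI[OF scheduler_val_balanced_ge[OF that(2)]
        scheduler_val_le_linear[OF is_balanced_imp_lazy[OF that(2)]]]
      fail_ratio_eq[OF that(1)] by simp
  ultimately show ?thesis
    using is_balanced_balanced_scheduler is_balanced_imp_lazy tendsto_ratio_formula ratio_limit_approx
    by simp blast
qed

end
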